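(* Let $p\in[1,\infty)$. Assume that the prior satisfies the Kullback--Leibler condition $$\liminf_{n\to\infty}\Pi_n\big(\{q\in\mathcal F: K(p_0,q)<\epsilon\}\big)>0\quad\text{for every }\epsilon>0.$$ Furthermore, assume that there exist positive constants $K$ and $\delta$ such that $M_{p+\delta}(P_0)<\infty$ and $$\Pi_n\big(M_{p+\delta}(P)\le K\mid X_1,\ldots,X_n\big)\to 1\quad\text{in probability.}$$ Then for every $\epsilon>0$, $$\Pi_n\big(W_p(P,P_0)>\epsilon\mid X_1,\ldots,X_n\big)\to 0\quad\text{in probability.}$$
   Context: Setting: $X_1,X_2,\ldots$ are i.i.d. real random variables from a true distribution $P_0$ having a Lebesgue density $p_0$ on $\mathbb R$. $\mathcal F$ is a collection of probability densities on $\mathbb R$ equipped with the weak topology, and $\Pi=\Pi_n$ is a prior (a probability measure on $\mathcal F$), which may depend on the sample size $n$. For a measurable $A\subset\mathcal F$ the posterior probability is $$\Pi_n(A\mid X_1,\ldots,X_n)=\frac{\int_A\prod_{i=1}^n q(X_i)/p_0(X_i)\,d\Pi_n(q)}{\int_{\mathcal F}\prod_{i=1}^n q(X_i)/p_0(X_i)\,d\Pi_n(q)}.$$ A density is identified with its probability measure, and $P$ inside $\Pi_n(\cdot\mid X_1,\ldots,X_n)$ denotes the random probability measure whose density is drawn from the posterior. Convergence in probability is with respect to the true distribution $P_0$ of the data, as $n\to\infty$. Constants do not depend on $n$. Notation: $M_r(P)=\int|x|^r\,dP(x)$; $K(p_0,q)=\int\log[p_0(x)/q(x)]\,dP_0(x)$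 (a divergence, not to be confused with the constant $K$); $W_p(P,Q)=\inf_{\pi}\big(\int_{\mathbb R^2}|x-y|^p\,d\pi(x,y)\big)^{1/p}$, the infimum being over all couplings $\pi$ of $P$ and $Q$ (Borel probability measures on $\mathbb R^2$ with marginals $P$ and $Q$). *)

theory Defs
  imports "HOL-Probability.Probability"
begin

definition law :: "(real \<Rightarrow> real) \<Rightarrow> real measure" where
  "law q = density lborel (\<lambda>x. ennreal (q x))"

definition prob_density :: "(real \<Rightarrow> real) \<Rightarrow> bool" where
  "prob_density q \<longleftrightarrow> q \<in> borel_measurable borel \<and> (\<forall>x. 0 \<le> q x) \<and> prob_space (law q)"

text \<open>
  The weak topology on a set of densities is the one induced by integration of bounded
  continuous functions.  It sees a density only through its law.
\<close>
definition weak_topology :: "(real \<Rightarrow> real) set \<Rightarrow> (real \<Rightarrow> real) topology" where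
  "weak_topology F = topology_generated_by
     {{q \<in> F. (\<integral>x. g x \<partial>law q) \<in> U} | (g :: real \<Rightarrow> real) (U :: real set).
        continuous_on UNIV g \<and> bounded (range g) \<and> open U}"

definition weak_borel :: "(real \<Rightarrow> real) set \<Rightarrow> (real \<Rightarrow> real) measure" where
  "weak_borel F = sigma F {U. openin (weak_topology F) U}"

text \<open>
  Members of \<open>F\<close> are functions, but are identified with their laws.  The likelihood needs
  values \<open>q x\<close>, so for the posterior to be defined \<open>(q, x) \<mapsto> q x\<close> has to be jointly measurable.
  As the Borel sets of the weak topology do not separate densities with the same law, joint
  measurability means in particular that \<open>F\<close> contains one version of each density.  This does not
  restrict the collection of laws: a jointly measurable choice of versions always exists, e.g. the
  upper limit of \<open>n * P {x<..x + 1/n}\<close> (set to 0 where that is infinite).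
\<close>
definition density_model :: "(real \<Rightarrow> real) set \<Rightarrow> bool" where
  "density_model F \<longleftrightarrow> (\<forall>q\<in>F. prob_density q) \<and>
     (\<lambda>(q, x). q x) \<in> borel_measurable (weak_borel F \<Otimes>\<^sub>M borel)"

definition prior_on :: "(real \<Rightarrow> real) set \<Rightarrow> (real \<Rightarrow> real) measure \<Rightarrow> bool" where
  "prior_on F Pr \<longleftrightarrow> prob_space Pr \<and> sets Pr = sets (weak_borel F)"

definition likelihood_ratio ::
    "(real \<Rightarrow> real) \<Rightarrow> nat \<Rightarrow> (nat \<Rightarrow> real) \<Rightarrow> (real \<Rightarrow> real) \<Rightarrow> real" where
  "likelihood_ratio p0 n x q = (\<Prod>i\<in>{1..n}. q (x i) / p0 (x i))"

text \<open>
  The quotient below is 0 when the denominator is 0 or infinite.  The latter happens with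
  probability 0 for data from \<open>p0\<close>.
\<close>
definition posterior ::
    "(real \<Rightarrow> real) measure \<Rightarrow> (real \<Rightarrow> real) \<Rightarrow> nat \<Rightarrow> (nat \<Rightarrow> real) \<Rightarrow> (real \<Rightarrow> real) set \<Rightarrow> real" where
  "posterior Pr p0 n x A = enn2real
     ((\<integral>\<^sup>+q\<in>A. ennreal (likelihood_ratio p0 n x q) \<partial>Pr) /
      (\<integral>\<^sup>+q. ennreal (likelihood_ratio p0 n x q) \<partial>Pr))"

definition abs_moment :: "real \<Rightarrow> real measure \<Rightarrow> ennreal" where
  "abs_moment r P = (\<integral>\<^sup>+x. ennreal (\<bar>x\<bar> powr r) \<partial>P)"

text \<open>
  The library's \<open>KL_divergence\<close> is a Bochner integral and hence 0 when the integral diverges; here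
  a divergent integral has to count as infinite.  Points with \<open>p0 x = 0\<close> do not matter under
  \<open>law p0\<close>.  The negative part has a finite integral whenever \<open>p0\<close> and \<open>q\<close> are probability
  densities, so the difference below is never of the form \<open>\<infinity> - \<infinity>\<close>.
\<close>
definition log_ratio :: "(real \<Rightarrow> real) \<Rightarrow> (real \<Rightarrow> real) \<Rightarrow> real \<Rightarrow> ereal" where
  "log_ratio p0 q x = (if q x = 0 then \<infinity> else ereal (ln (p0 x / q x)))"

definition KL :: "(real \<Rightarrow> real) \<Rightarrow> (real \<Rightarrow> real) \<Rightarrow> ereal" where
  "KL p0 q = enn2ereal (\<integral>\<^sup>+x. e2ennreal (max 0 (log_ratio p0 q x)) \<partial>law p0)
           - enn2ereal (\<integral>\<^sup>+x. e2ennreal (max 0 (- log_ratio p0 q x)) \<partial>law p0)"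

definition couplings :: "real measure \<Rightarrow> real measure \<Rightarrow> (real \<times> real) measure set" where
  "couplings P Q = {\<pi>. prob_space \<pi> \<and> sets \<pi> = sets borel \<and>
     distr \<pi> borel fst = P \<and> distr \<pi> borel snd = Q}"

definition ennreal_powr :: "ennreal \<Rightarrow> real \<Rightarrow> ennreal" where
  "ennreal_powr x r = (if x = \<infinity> then \<infinity> else ennreal (enn2real x powr r))"

definition wasserstein :: "real \<Rightarrow> real measure \<Rightarrow> real measure \<Rightarrow> ennreal" where
  "wasserstein p P Q = (INF \<pi>\<in>couplings P Q.
     ennreal_powr (\<integral>\<^sup>+(x, y). ennreal (\<bar>x - y\<bar> powr p) \<partial>\<pi>) (1 / p))"

text \<open>
  For measurable \<open>Y n\<close> the outer measure is just the probability; it is used because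
  \<open>measure\<close> assigns 0 to non-measurable sets.
\<close>
definition tendsto_in_prob :: "'w measure \<Rightarrow> (nat \<Rightarrow> 'w \<Rightarrow> real) \<Rightarrow> real \<Rightarrow> bool" where
  "tendsto_in_prob M Y c \<longleftrightarrow>
     (\<forall>\<eta>>0. (\<lambda>n. outer_measure_of M {\<omega> \<in> space M. \<bar>Y n \<omega> - c\<bar> > \<eta>}) \<longlonglongrightarrow> 0)"

end

theory Submission
  imports Defs
begin

text \<open>
  For the Wasserstein distance, cut most of the mass of \<open>P0\<close> into finitely many short cells \<open>J k\<close> of
  positive mass. If \<open>P (J k) \<ge> (1 - \<kappa>) * P0 (J k)\<close> for all \<open>k\<close>, then \<open>(1 - \<kappa>) * P0 (J k)\<close> units of
  mass can be coupled within each cell; the small remainder is coupled independently, and the moment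
  bounds of order \<open>p + \<delta>\<close> keep its cost small. So it suffices that the posterior mass of each set
  \<open>{q. P (J k) < (1 - \<kappa>) * P0 (J k)}\<close> vanishes.

  The numerator of that posterior mass is multiplied by the exponential weight
  \<open>exp (\<lambda> * (\<Sum>i. indicator (J k) (X i) - c))\<close>, which is at least 1 with high probability, and the
  weighted numerator has an exponentially small expectation by Fubini and a Chernoff bound.

  For the denominator no law of large numbers is available, because the prior depends on \<open>n\<close>. However,
  the expectation of the positive part of \<open>ln (p0 / q)\<close> under \<open>P0\<close> is of order \<open>sqrt (KL p0 q)\<close>, so
  Markov's inequality, applied first to the data and then to the prior, bounds the denominator below by
  \<open>c / 2 * exp (- n * b)\<close> outside an event of probability \<open>O(\<gamma> / b)\<close>, where \<open>\<gamma>\<^sup>2\<close> is the radius of the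
  Kullback-Leibler neighbourhood. The radius is arbitrary, hence \<open>\<gamma>\<close> can be sent to 0 for fixed \<open>b\<close>.
\<close>

section \<open>Convergence in probability\<close>

lemma nn_integral_Markov_real:
  fixes a :: real
  assumes [measurable]: "u \<in> borel_measurable M" and "a > 0"
  shows "emeasure M {x \<in> space M. ennreal a \<le> u x} \<le> ennreal (1 / a) * (\<integral>\<^sup>+x. u x \<partial>M)"
proof -
  have "1 \<le> ennreal (1 / a) * v" if "ennreal a \<le> v" for v
  proof -
    have "1 = ennreal (1 / a) * ennreal a"
      using \<open>a > 0\<close> by (subst ennreal_mult[symmetric]) auto
    also have "\<dots> \<le> ennreal (1 / a) * v"
      by (intro mult_left_mono that) simp
    finally show ?thesis .
  qed
  then have "emeasure M {x \<in> space M. ennreal a \<le> u x} \<le>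
      emeasure M {x \<in> space M. 1 \<le> ennreal (1 / a) * u x}"
    by (intro emeasure_mono) auto
  also have "\<dots> \<le> ennreal (1 / a) * (\<integral>\<^sup>+x. u x * indicator (space M) x \<partial>M)"
    by (intro nn_integral_Markov_inequality) auto
  also have "(\<integral>\<^sup>+x. u x * indicator (space M) x \<partial>M) = (\<integral>\<^sup>+x. u x \<partial>M)"
    by (intro nn_integral_cong) simp
  finally show ?thesis .
qed

text \<open>Replace both sets by measurable covers of the same outer measure. Arbitrary subsets have
  to be allowed because no posterior probability is shown to be measurable in the data.\<close>

lemma outer_measure_of_Un_le:
  assumes "A \<subseteq> space M" "B \<subseteq> space M"
  shows "outer_measure_of M (A \<union> B) \<le> outer_measure_of M A + outer_measure_of M B"
proof -
  obtain A' B' where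
    "A' \<in> sets M" "A \<subseteq> A'" "outer_measure_of M A = emeasure M A'"
    "B' \<in> sets M" "B \<subseteq> B'" "outer_measure_of M B = emeasure M B'"
    using outer_measure_of_attain[OF assms(1)] outer_measure_of_attain[OF assms(2)] by blast
  note * = this
  have "outer_measure_of M (A \<union> B) \<le> outer_measure_of M (A' \<union> B')"
    using * by (intro outer_measure_of_mono) auto
  also have "\<dots> = emeasure M (A' \<union> B')"
    using * by (intro outer_measure_of_eq) auto
  also have "\<dots> \<le> emeasure M A' + emeasure M B'"
    using * by (intro emeasure_subadditive)
  finally show ?thesis
    using * by simp
qed

lemma tendsto_zero_ennrealI:
  fixes f :: "'a \<Rightarrow> ennreal"
  assumes "\<And>\<tau>::real. \<tau> > 0 \<Longrightarrow> eventually (\<lambda>n. f n \<le> ennreal \<tau>) G"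
  shows "(f \<longlongrightarrow> 0) G"
proof (rule order_tendstoI)
  fix a :: ennreal assume "0 < a"
  then obtain b where b: "0 < b" "b < a"
    using dense by blast
  then obtain \<tau> where "b = ennreal \<tau>" "\<tau> > 0"
    by (cases b) auto
  with b assms[of \<tau>] show "eventually (\<lambda>n. f n < a) G"
    by (auto elim: eventually_mono intro: le_less_trans)
qed simp

lemma tendsto_zero_ennreal_mono:
  fixes f g :: "'a \<Rightarrow> ennreal"
  assumes "\<And>n. f n \<le> g n" "(g \<longlongrightarrow> 0) G"
  shows "(f \<longlongrightarrow> 0) G"
  using assms by (intro tendsto_sandwich[of "\<lambda>_. 0" f G g]) simp_all

text \<open>A measurable exceptional event \<open>B\<close> that covers the deviation set controls
  its outer measure, so \<open>Y n\<close> itself may be non-measurable. The posterior bounds come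
  in exactly this form.\<close>

lemma tendsto_in_prob_zeroI:
  assumes "\<And>\<eta> \<tau>::real. \<eta> > 0 \<Longrightarrow> \<tau> > 0 \<Longrightarrow> eventually (\<lambda>n.
    \<exists>B\<in>sets M. {\<omega> \<in> space M. \<bar>Y n \<omega>\<bar> > \<eta>} \<subseteq> B \<and> emeasure M B \<le> ennreal \<tau>) sequentially"
  shows "tendsto_in_prob M Y 0"
  unfolding tendsto_in_prob_def
proof (intro allI impI tendsto_zero_ennrealI)
  fix \<eta> \<tau> :: real assume "\<eta> > 0" "\<tau> > 0"
  from assms[OF this]
  show "eventually (\<lambda>n. outer_measure_of M {\<omega> \<in> space M. \<bar>Y n \<omega> - 0\<bar> > \<eta>} \<le> ennreal \<tau>) sequentially"
  proof eventually_elim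
    case (elim n)
    then obtain B where B: "B \<in> sets M" "{\<omega> \<in> space M. \<bar>Y n \<omega>\<bar> > \<eta>} \<subseteq> B" "emeasure M B \<le> ennreal \<tau>"
      by blast
    then show ?case
      using outer_measure_of_mono[OF B(2), of M] by simp
  qed
qed

text \<open>The deviation sets are nested. The limit \<open>c\<close> is left general because the
  moment assumption is used with \<open>c = 1\<close>, to pass to a complement.\<close>

lemma tendsto_in_prob_zero_mono:
  assumes Y: "tendsto_in_prob M Y c"
    and le: "\<And>n \<omega>. \<omega> \<in> space M \<Longrightarrow> \<bar>Z n \<omega>\<bar> \<le> \<bar>Y n \<omega> - c\<bar>"
  shows "tendsto_in_prob M Z 0"
  unfolding tendsto_in_prob_def
proof (intro allI impI)
  fix \<eta> :: real assume "\<eta> > 0"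
  with Y have "(\<lambda>n. outer_measure_of M {\<omega> \<in> space M. \<bar>Y n \<omega> - c\<bar> > \<eta>}) \<longlonglongrightarrow> 0"
    unfolding tendsto_in_prob_def by blast
  moreover have "outer_measure_of M {\<omega> \<in> space M. \<bar>Z n \<omega> - 0\<bar> > \<eta>} \<le>
      outer_measure_of M {\<omega> \<in> space M. \<bar>Y n \<omega> - c\<bar> > \<eta>}" for n
  proof (intro outer_measure_of_mono subsetI)
    fix \<omega> assume "\<omega> \<in> {\<omega> \<in> space M. \<bar>Z n \<omega> - 0\<bar> > \<eta>}"
    then show "\<omega> \<in> {\<omega> \<in> space M. \<bar>Y n \<omega> - c\<bar> > \<eta>}"
      using le[of \<omega> n] unfolding mem_Collect_eq diff_0_right by (blast intro: less_le_trans)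
  qed
  ultimately show "(\<lambda>n. outer_measure_of M {\<omega> \<in> space M. \<bar>Z n \<omega> - 0\<bar> > \<eta>}) \<longlonglongrightarrow> 0"
    by (rule tendsto_zero_ennreal_mono[rotated])
qed

lemma tendsto_in_prob_zero_add:
  assumes Y: "tendsto_in_prob M Y 0" and Z: "tendsto_in_prob M Z 0"
  shows "tendsto_in_prob M (\<lambda>n \<omega>. Y n \<omega> + Z n \<omega>) 0"
  unfolding tendsto_in_prob_def
proof (intro allI impI)
  fix \<eta> :: real assume "\<eta> > 0"
  let ?S = "\<lambda>V n. {\<omega> \<in> space M. \<bar>V n \<omega>\<bar> > \<eta> / 2}"
  have lim: "(\<lambda>n. outer_measure_of M (?S Y n) + outer_measure_of M (?S Z n)) \<longlonglongrightarrow> 0"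
    using Y Z half_gt_zero[OF \<open>\<eta> > 0\<close>] unfolding tendsto_in_prob_def
    by (intro tendsto_add_zero) (simp_all only: diff_0_right)
  have "outer_measure_of M {\<omega> \<in> space M. \<bar>Y n \<omega> + Z n \<omega> - 0\<bar> > \<eta>} \<le>
      outer_measure_of M (?S Y n) + outer_measure_of M (?S Z n)" for n
    by (rule order.trans[OF outer_measure_of_mono outer_measure_of_Un_le]) auto
  then show "(\<lambda>n. outer_measure_of M {\<omega> \<in> space M. \<bar>Y n \<omega> + Z n \<omega> - 0\<bar> > \<eta>}) \<longlonglongrightarrow> 0"
    by (intro tendsto_zero_ennreal_mono[OF _ lim])
qed

lemma tendsto_in_prob_zero_sum:
  assumes "finite S" "\<And>k. k \<in> S \<Longrightarrow> tendsto_in_prob M (Y k) 0"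
  shows "tendsto_in_prob M (\<lambda>n \<omega>. \<Sum>k\<in>S. Y k n \<omega>) 0"
  using assms
proof (induction S)
  case empty
  have "outer_measure_of M {} = 0"
    by (simp add: outer_measure_of_eq)
  then show ?case
    by (simp add: tendsto_in_prob_def)
next
  case (insert k S)
  then show ?case
    using tendsto_in_prob_zero_add[of M "Y k" "\<lambda>n \<omega>. \<Sum>k\<in>S. Y k n \<omega>"] by simp
qed

section \<open>Exponential moments under i.i.d. sampling\<close>

lemma sets_law [measurable_cong, simp]: "sets (law q) = sets borel"
  and space_law [simp]: "space (law q) = UNIV"
  by (simp_all add: law_def)

lemma prob_density_measurable: "prob_density q \<Longrightarrow> q \<in> borel_measurable borel"
  and prob_density_nonneg: "prob_density q \<Longrightarrow> 0 \<le> q x"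
  and prob_density_prob_space: "prob_density q \<Longrightarrow> prob_space (law q)"
  by (simp_all add: prob_density_def)

lemma nn_integral_law:
  assumes "prob_density q" "g \<in> borel_measurable borel"
  shows "(\<integral>\<^sup>+x. g x \<partial>law q) = (\<integral>\<^sup>+x. ennreal (q x) * g x \<partial>lborel)"
  using assms unfolding law_def by (subst nn_integral_density) (auto simp: prob_density_def)

text \<open>Chernoff bound for a single observation, with tilt \<open>l = \<eta> / 2\<close>. The
  integral is computed exactly and then bounded with \<open>1 + t \<le> exp t\<close>. It serves
  both for the law of the data and for laws in the model.\<close>

lemma (in prob_space) nn_integral_exp_indicator_le:
  fixes c \<eta> :: real
  assumes [measurable]: "I \<in> sets M" and "measure M I \<le> c - \<eta>" "0 \<le> \<eta>" "\<eta> \<le> 1"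
  shows "(\<integral>\<^sup>+x. ennreal (exp (\<eta> / 2 * (indicator I x - c))) \<partial>M) \<le> ennreal (exp (- (\<eta>\<^sup>2 / 4)))"
proof -
  define l where "l = \<eta> / 2"
  define Q where "Q = measure M I"
  have Q: "0 \<le> Q" "Q \<le> 1" "Q \<le> c - \<eta>"
    using assms by (auto simp: Q_def)
  have l: "0 \<le> l" "l \<le> 1" "\<eta> = 2 * l"
    using assms by (auto simp: l_def)
  have "(\<integral>\<^sup>+x. ennreal (exp (l * (indicator I x - c))) \<partial>M) =
      (\<integral>\<^sup>+x. ennreal (exp (- l * c) * (exp l - 1)) * indicator I x + ennreal (exp (- l * c)) \<partial>M)"
  proof (intro nn_integral_cong)
    fix x
    have "exp (l * (1 - c)) = exp (- l * c) * (exp l - 1) + exp (- l * c)"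
      by (simp add: right_diff_distrib flip: exp_add)
    then show "ennreal (exp (l * (indicator I x - c))) =
        ennreal (exp (- l * c) * (exp l - 1)) * indicator I x + ennreal (exp (- l * c))"
      using l by (simp split: split_indicator flip: ennreal_plus)
  qed
  also have "\<dots> = ennreal (exp (- l * c) * (exp l - 1)) * ennreal Q + ennreal (exp (- l * c))"
    by (subst nn_integral_add) (auto simp: nn_integral_cmult_indicator emeasure_eq_measure Q_def emeasure_space_1 prob_space)
  also have "\<dots> = ennreal (exp (- l * c) * (1 + Q * (exp l - 1)))"
    using l Q by (subst ennreal_mult[symmetric], simp, simp, subst ennreal_plus[symmetric])
      (auto simp: algebra_simps intro!: mult_left_mono)
  also have "exp (- l * c) * (1 + Q * (exp l - 1)) \<le> exp (- l * c) * exp (Q * (exp l - 1))"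
    by (intro mult_left_mono exp_ge_add_one_self) simp
  also have "\<dots> = exp (- l * c + Q * (exp l - 1))"
    by (simp only: exp_add)
  also have "\<dots> \<le> exp (- (\<eta>\<^sup>2 / 4))"
  proof -
    \<comment> \<open>For \<open>l\<close> in the unit interval \<open>exp l - 1\<close> is at most
      \<open>l + l\<^sup>2\<close>. The exponent is then at most
      \<open>- \<eta> * l + l\<^sup>2\<close>, which is \<open>- l\<^sup>2\<close> because
      \<open>\<eta> = 2 * l\<close>.\<close>
    have "Q * (exp l - 1) \<le> Q * (l + l\<^sup>2)"
      using exp_bound[of l] l Q by (intro mult_left_mono) auto
    also have "\<dots> \<le> (c - \<eta>) * l + 1 * l\<^sup>2"
      unfolding distrib_left using l Q by (intro add_mono mult_right_mono) auto
    finally show ?thesis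
      using l by (simp add: power2_eq_square algebra_simps)
  qed
  finally show ?thesis
    unfolding l_def by (simp add: ennreal_leI)
qed

locale iid_sample = prob_space M for M :: "'w measure" +
  fixes X :: "nat \<Rightarrow> 'w \<Rightarrow> real" and p0 :: "real \<Rightarrow> real"
  assumes density: "prob_density p0"
    and indep: "indep_vars (\<lambda>_. borel) X {1..}"
    and distr: "\<And>i. i \<ge> 1 \<Longrightarrow> distributed M lborel (X i) (\<lambda>x. ennreal (p0 x))"
begin

sublocale P0: prob_space "law p0"
  using density by (rule prob_density_prob_space)

lemma measurable_p0 [measurable]: "p0 \<in> borel_measurable borel"
  using density by (rule prob_density_measurable)

lemma measurable_X: "i \<ge> 1 \<Longrightarrow> X i \<in> borel_measurable M"
  using distributed_measurable[OF distr] by simp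

lemma nn_integral_X:
  assumes "i \<ge> 1" "g \<in> borel_measurable borel"
  shows "(\<integral>\<^sup>+\<omega>. g (X i \<omega>) \<partial>M) = (\<integral>\<^sup>+x. g x \<partial>law p0)"
  using distributed_nn_integral[OF distr, of i g] assms nn_integral_law[OF density, of g] by simp

lemma nn_integral_prod_X:
  fixes g :: "real \<Rightarrow> ennreal"
  assumes [measurable]: "g \<in> borel_measurable borel"
  shows "(\<integral>\<^sup>+\<omega>. (\<Prod>i\<in>{1..n}. g (X i \<omega>)) \<partial>M) = (\<integral>\<^sup>+x. g x \<partial>law p0) ^ n"
proof -
  have "indep_vars (\<lambda>_. borel) (\<lambda>i \<omega>. g (X i \<omega>)) {1..n}"
    by (rule indep_vars_compose2[OF indep_vars_subset[OF indep]]) auto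
  then have "(\<integral>\<^sup>+\<omega>. (\<Prod>i\<in>{1..n}. g (X i \<omega>)) \<partial>M) = (\<Prod>i\<in>{1..n}. \<integral>\<^sup>+\<omega>. g (X i \<omega>) \<partial>M)"
    by (intro indep_vars_nn_integral) auto
  also have "\<dots> = (\<Prod>i\<in>{1..n}. \<integral>\<^sup>+x. g x \<partial>law p0)"
    by (intro prod.cong nn_integral_X) auto
  finally show ?thesis
    by simp
qed

lemma AE_p0_pos: "AE x in law p0. 0 < p0 x"
  unfolding law_def by (subst AE_density) (auto simp: prob_density_nonneg[OF density])

text \<open>Where \<open>p0\<close> vanishes, division by zero makes the ratio
  \<open>q x / p0 x\<close> equal to 0. Lower bounds for the likelihood therefore need samples that
  avoid these points.\<close>

lemma AE_X_pos: "AE \<omega> in M. \<forall>i\<in>{1..n}. 0 < p0 (X i \<omega>)"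
proof (rule AE_finite_allI)
  fix i :: nat assume i: "i \<in> {1..n}"
  then have [measurable]: "X i \<in> borel_measurable M"
    by (intro measurable_X) simp
  have "(\<integral>\<^sup>+\<omega>. indicator {x. \<not> 0 < p0 x} (X i \<omega>) \<partial>M) = emeasure (law p0) {x. \<not> 0 < p0 x}"
    using i by (subst nn_integral_X) auto
  also have "\<dots> = 0"
    using AE_p0_pos by (subst (asm) AE_iff_measurable[OF _ refl]) auto
  finally have "AE \<omega> in M. indicator {x. \<not> 0 < p0 x} (X i \<omega>) = (0 :: ennreal)"
    by (subst (asm) nn_integral_0_iff_AE) auto
  then show "AE \<omega> in M. 0 < p0 (X i \<omega>)"
    by eventually_elim (simp split: split_indicator_asm)
qed simp

text \<open>Change of measure from \<open>law p0\<close> to \<open>law q\<close>. Only an inequality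
  holds, since the mass of \<open>q\<close> on the zeros of \<open>p0\<close> is lost.\<close>

lemma nn_integral_ratio_le:
  assumes q: "prob_density q" and [measurable]: "g \<in> borel_measurable borel"
  shows "(\<integral>\<^sup>+x. ennreal (q x / p0 x) * g x \<partial>law p0) \<le> (\<integral>\<^sup>+x. g x \<partial>law q)"
proof -
  have [measurable]: "q \<in> borel_measurable borel"
    using q by (rule prob_density_measurable)
  have "(\<integral>\<^sup>+x. ennreal (q x / p0 x) * g x \<partial>law p0) =
      (\<integral>\<^sup>+x. ennreal (p0 x) * (ennreal (q x / p0 x) * g x) \<partial>lborel)"
    by (subst nn_integral_law[OF density]) auto
  also have "\<dots> \<le> (\<integral>\<^sup>+x. ennreal (q x) * g x \<partial>lborel)"
  proof (intro nn_integral_mono)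
    fix x
    have "ennreal (p0 x) * ennreal (q x / p0 x) \<le> ennreal (q x)"
      using prob_density_nonneg[OF density, of x] prob_density_nonneg[OF q, of x]
      by (cases "p0 x = 0") (auto simp flip: ennreal_mult')
    then show "ennreal (p0 x) * (ennreal (q x / p0 x) * g x) \<le> ennreal (q x) * g x"
      by (metis mult.assoc mult_right_mono zero_le)
  qed
  also have "\<dots> = (\<integral>\<^sup>+x. g x \<partial>law q)"
    by (subst nn_integral_law[OF q]) auto
  finally show ?thesis .
qed

text \<open>A low frequency of \<open>I\<close> is a high frequency of its complement. The
  complement has mass exactly \<open>c - \<eta>\<close> with the \<open>c\<close> defined in the
  proof, so the one-observation Chernoff bound applies and independence raises it to the power
  \<open>n\<close>.\<close>

lemma emeasure_frequency_le:
  fixes \<eta> :: real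
  assumes [measurable]: "I \<in> sets borel" and "0 < \<eta>" "\<eta> \<le> 1"
  shows "emeasure M {\<omega> \<in> space M. (\<Sum>i\<in>{1..n}. indicator I (X i \<omega>) - (measure (law p0) I - \<eta>)) \<le> 0}
      \<le> ennreal (exp (- real n * \<eta>\<^sup>2 / 4))"
proof -
  define c where "c = 1 - (measure (law p0) I - \<eta>)"
  let ?g = "\<lambda>x. exp (\<eta> / 2 * (indicator (- I) x - c))"
  let ?S = "\<lambda>\<omega>. \<Sum>i\<in>{1..n}. indicator I (X i \<omega>) - (measure (law p0) I - \<eta>)"
  have X [measurable]: "\<And>i. i \<in> {1..n} \<Longrightarrow> X i \<in> borel_measurable M"
    by (intro measurable_X) simp
  have prod: "(\<Prod>i\<in>{1..n}. ?g (X i \<omega>)) = exp (\<eta> / 2 * - ?S \<omega>)" for \<omega>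
    unfolding exp_sum[OF finite_atLeastAtMost, symmetric] sum_distrib_left[symmetric] sum_negf[symmetric]
    by (intro arg_cong[where f = exp] arg_cong2[where f = "(*)"] sum.cong refl)
      (auto simp: c_def split: split_indicator)
  have "emeasure M {\<omega> \<in> space M. ?S \<omega> \<le> 0} \<le>
      emeasure M {\<omega> \<in> space M. ennreal 1 \<le> (\<Prod>i\<in>{1..n}. ennreal (?g (X i \<omega>)))}"
  proof (intro emeasure_mono subsetI)
    fix \<omega> assume "\<omega> \<in> {\<omega> \<in> space M. ?S \<omega> \<le> 0}"
    then have "\<omega> \<in> space M" "0 \<le> \<eta> / 2 * - ?S \<omega>"
      using \<open>0 < \<eta>\<close> by (simp_all add: mult_nonneg_nonpos)
    then show "\<omega> \<in> {\<omega> \<in> space M. ennreal 1 \<le> (\<Prod>i\<in>{1..n}. ennreal (?g (X i \<omega>)))}"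
      by (subst prod_ennreal, simp, subst prod) auto
  qed measurable
  also have "\<dots> \<le> ennreal (1 / 1) * (\<integral>\<^sup>+\<omega>. (\<Prod>i\<in>{1..n}. ennreal (?g (X i \<omega>))) \<partial>M)"
    by (intro nn_integral_Markov_real) auto
  also have "\<dots> = (\<integral>\<^sup>+x. ennreal (?g x) \<partial>law p0) ^ n"
    by (subst nn_integral_prod_X) auto
  also have "\<dots> \<le> ennreal (exp (- (\<eta>\<^sup>2 / 4))) ^ n"
    using assms P0.prob_compl[of I]
    by (intro power_mono P0.nn_integral_exp_indicator_le) (auto simp: c_def Compl_eq_Diff_UNIV)
  also have "\<dots> = ennreal (exp (- real n * \<eta>\<^sup>2 / 4))"
    by (simp add: ennreal_power exp_of_nat_mult[symmetric])
  finally show ?thesis .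
qed

end

section \<open>The positive part of the log-likelihood ratio\<close>

lemma e2ennreal_max_log_ratio:
  assumes "0 < p0 x" "0 < q x"
  shows "e2ennreal (max 0 (log_ratio p0 q x)) = ennreal (max 0 (- ln (q x / p0 x)))"
    and "e2ennreal (max 0 (- log_ratio p0 q x)) = ennreal (max 0 (ln (q x / p0 x)))"
  using assms by (auto simp: log_ratio_def ln_div max_def ennreal.abs_eq[symmetric] zero_ereal_def e2ennreal_ereal)

lemma e2ennreal_max_log_ratio_zero:
  assumes "q x = 0"
  shows "e2ennreal (max 0 (log_ratio p0 q x)) = \<infinity>" "e2ennreal (max 0 (- log_ratio p0 q x)) = 0"
  using assms by (simp_all add: log_ratio_def max_def e2ennreal_infty)

lemma measurable_log_ratio:
  assumes [measurable]: "p0 \<in> borel_measurable borel" "g \<in> borel_measurable N"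
    "(\<lambda>y. f y (g y)) \<in> borel_measurable N"
  shows "(\<lambda>y. log_ratio p0 (f y) (g y)) \<in> borel_measurable N"
  unfolding log_ratio_def by measurable

text \<open>A finite sum of positive parts excludes \<open>q (x i) = 0\<close>, where the summand
  would be infinite. Hence all logarithms are genuine, and minus their sum is at most the sum of the
  positive parts.\<close>

lemma exp_le_prod_ratio:
  assumes "finite J" "\<And>i. i \<in> J \<Longrightarrow> 0 < p0 (x i)" "\<And>i. i \<in> J \<Longrightarrow> 0 \<le> q (x i)"
    and less: "(\<Sum>i\<in>J. e2ennreal (max 0 (log_ratio p0 q (x i)))) < ennreal s"
  shows "exp (- s) \<le> (\<Prod>i\<in>J. q (x i) / p0 (x i))"
proof -
  have fin: "e2ennreal (max 0 (log_ratio p0 q (x i))) < \<infinity>" if "i \<in> J" for i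
    using member_le_sum[of i J "\<lambda>i. e2ennreal (max 0 (log_ratio p0 q (x i)))"] that \<open>finite J\<close> less
    by (auto intro: le_less_trans less_trans)
  have pos: "0 < q (x i)" if "i \<in> J" for i
  proof -
    have "q (x i) \<noteq> 0"
      using fin[OF that] e2ennreal_max_log_ratio_zero(1)[of q "x i" p0] by auto
    then show ?thesis
      using assms(3)[OF that] by simp
  qed
  have "(\<Sum>i\<in>J. e2ennreal (max 0 (log_ratio p0 q (x i)))) =
      (\<Sum>i\<in>J. ennreal (max 0 (- ln (q (x i) / p0 (x i)))))"
    using pos assms(2) by (intro sum.cong e2ennreal_max_log_ratio) auto
  also have "\<dots> = ennreal (\<Sum>i\<in>J. max 0 (- ln (q (x i) / p0 (x i))))"
    by (intro sum_ennreal) simp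
  finally have "(\<Sum>i\<in>J. max 0 (- ln (q (x i) / p0 (x i)))) < s"
    using less by (simp add: ennreal_less_iff sum_nonneg)
  moreover have "- (\<Sum>i\<in>J. ln (q (x i) / p0 (x i))) \<le> (\<Sum>i\<in>J. max 0 (- ln (q (x i) / p0 (x i))))"
    unfolding sum_negf[symmetric] by (intro sum_mono) simp
  ultimately have "exp (- s) \<le> exp (\<Sum>i\<in>J. ln (q (x i) / p0 (x i)))"
    by simp
  also have "\<dots> = (\<Prod>i\<in>J. q (x i) / p0 (x i))"
    using pos assms(1,2) by (simp add: exp_sum)
  finally show ?thesis .
qed

text \<open>Write \<open>a\<close> and \<open>b\<close> for the integrals of the positive and
  negative parts of the log ratio. Integrating the inequality \<open>real\<close> gives
  \<open>\<gamma> * b + b \<le> \<gamma>\<^sup>2 / 2 + a\<close>, and the divergence bound gives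
  \<open>a < b + \<gamma>\<^sup>2\<close>. Together they yield
  \<open>b \<le> 3 / 2 * \<gamma>\<close>, and then \<open>a \<le> 3 * \<gamma>\<close> since
  \<open>\<gamma> \<le> 1\<close>.\<close>

lemma (in iid_sample) nn_integral_log_ratio_le:
  assumes q: "prob_density q" and KL: "KL p0 q < ereal (\<gamma>\<^sup>2)" and \<gamma>: "0 < \<gamma>" "\<gamma> \<le> 1"
  shows "(\<integral>\<^sup>+x. e2ennreal (max 0 (log_ratio p0 q x)) \<partial>law p0) \<le> ennreal (3 * \<gamma>)"
proof -
  define P where "P x = e2ennreal (max 0 (log_ratio p0 q x))" for x
  define N where "N x = e2ennreal (max 0 (- log_ratio p0 q x))" for x
  have [measurable]: "q \<in> borel_measurable borel"
    using q by (rule prob_density_measurable)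
  have [measurable]: "P \<in> borel_measurable borel" "N \<in> borel_measurable borel"
    unfolding P_def N_def by (measurable; auto intro!: measurable_log_ratio)+
  have ratio: "(\<integral>\<^sup>+x. ennreal (q x / p0 x) \<partial>law p0) \<le> 1"
    using nn_integral_ratio_le[OF q, of "\<lambda>_. 1"] prob_space.emeasure_space_1[OF prob_density_prob_space[OF q]]
    by simp
  text \<open>
    To be used with \<open>y = ln (q / p0)\<close>; for positive \<open>y\<close> it follows from \<open>exp y \<ge> 1 + y + y\<^sup>2 / 2\<close> and
    \<open>2 * \<gamma> * y \<le> \<gamma>\<^sup>2 + y\<^sup>2\<close>.
  \<close>
  have real: "\<gamma> * max 0 y + 1 + max 0 y \<le> \<gamma>\<^sup>2 / 2 + exp y + max 0 (- y)" for y
  proof (cases "y \<le> 0")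
    case True
    moreover have "0 \<le> \<gamma>\<^sup>2 / 2"
      by simp
    moreover have "1 + y \<le> exp y"
      by (rule exp_ge_add_one_self)
    ultimately have "1 \<le> \<gamma>\<^sup>2 / 2 + exp y - y"
      by linarith
    then show ?thesis
      using True by (simp add: max_def)
  next
    case False
    then have "1 + y + y\<^sup>2 / 2 \<le> exp y"
      by (intro exp_lower_Taylor_quadratic) simp
    moreover have "0 \<le> (\<gamma> - y)\<^sup>2"
      by simp
    ultimately show ?thesis
      using False by (simp add: power2_diff max_def)
  qed
  have pointwise: "ennreal \<gamma> * N x + 1 + N x \<le> ennreal (\<gamma>\<^sup>2 / 2) + ennreal (q x / p0 x) + P x"
    "N x \<le> ennreal (q x / p0 x)" if "0 < p0 x" for x
  proof -
    have "(ennreal \<gamma> * N x + 1 + N x \<le> ennreal (\<gamma>\<^sup>2 / 2) + ennreal (q x / p0 x) + P x) \<and>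
      N x \<le> ennreal (q x / p0 x)"
    proof (cases "q x = 0")
      case True
      then show ?thesis
        using e2ennreal_max_log_ratio_zero[of q x p0] by (simp add: P_def N_def)
    next
      case False
      then have "0 < q x"
        using prob_density_nonneg[OF q, of x] by simp
      define y where "y = ln (q x / p0 x)"
      have y: "exp y = q x / p0 x"
        using that \<open>0 < q x\<close> by (simp add: y_def)
      have P: "P x = ennreal (max 0 (- y))" and N: "N x = ennreal (max 0 y)"
        using e2ennreal_max_log_ratio[of p0 x q] that \<open>0 < q x\<close> by (simp_all add: P_def N_def y_def)
      have "ennreal \<gamma> * N x + 1 + N x = ennreal (\<gamma> * max 0 y + 1 + max 0 y)"
        unfolding N using \<gamma> by (simp add: ennreal_mult)
      also have "\<dots> \<le> ennreal (\<gamma>\<^sup>2 / 2 + exp y + max 0 (- y))"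
        by (intro ennreal_leI real)
      also have "\<dots> = ennreal (\<gamma>\<^sup>2 / 2) + ennreal (q x / p0 x) + P x"
        unfolding P y[symmetric] by (subst ennreal_plus; simp)+
      moreover have "max 0 y \<le> exp y"
        using exp_ge_add_one_self[of y] by (intro max.boundedI) (simp, linarith)
      then have "N x \<le> ennreal (exp y)"
        unfolding N by (rule ennreal_leI)
      ultimately show ?thesis
        by (simp add: y)
    qed
    then show "ennreal \<gamma> * N x + 1 + N x \<le> ennreal (\<gamma>\<^sup>2 / 2) + ennreal (q x / p0 x) + P x"
      "N x \<le> ennreal (q x / p0 x)" by blast+
  qed
  define a b where "a = (\<integral>\<^sup>+x. P x \<partial>law p0)" and "b = (\<integral>\<^sup>+x. N x \<partial>law p0)"
  have one: "emeasure (law p0) UNIV = 1"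
    using P0.emeasure_space_1 by simp
  \<comment> \<open>Finiteness of \<open>b\<close> comes first. Only then does the bound on the
    extended real difference force \<open>a\<close> to be finite, so that the computation can
    continue in the reals.\<close>
  have "b \<le> (\<integral>\<^sup>+x. ennreal (q x / p0 x) \<partial>law p0)"
    unfolding b_def by (rule nn_integral_mono_AE, rule AE_mp[OF AE_p0_pos], rule AE_I2, rule impI, rule pointwise)
  with ratio have "b \<le> 1"
    by (rule order.trans[rotated])
  then obtain b' where b': "b = ennreal b'" "0 \<le> b'"
    by (cases b) (auto simp: top_unique)
  have KL': "enn2ereal a - enn2ereal b < ereal (\<gamma>\<^sup>2)"
    using KL by (simp add: KL_def a_def b_def P_def N_def)
  then obtain a' where a': "a = ennreal a'" "0 \<le> a'"
    using b' by (cases a) (auto simp: enn2ereal_ennreal)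
  have diff: "a' - b' < \<gamma>\<^sup>2"
    using KL' a' b' by (simp add: enn2ereal_ennreal)
  have "ennreal \<gamma> * b + 1 + b = (\<integral>\<^sup>+x. ennreal \<gamma> * N x + 1 + N x \<partial>law p0)"
    unfolding b_def by (simp add: nn_integral_add nn_integral_cmult one)
  also have "\<dots> \<le> (\<integral>\<^sup>+x. ennreal (\<gamma>\<^sup>2 / 2) + ennreal (q x / p0 x) + P x \<partial>law p0)"
    by (rule nn_integral_mono_AE, rule AE_mp[OF AE_p0_pos], rule AE_I2, rule impI, rule pointwise)
  also have "\<dots> = ennreal (\<gamma>\<^sup>2 / 2) + (\<integral>\<^sup>+x. ennreal (q x / p0 x) \<partial>law p0) + a"
    using P0.emeasure_space_1 unfolding a_def by (simp add: nn_integral_add)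
  also have "\<dots> \<le> ennreal (\<gamma>\<^sup>2 / 2) + 1 + a"
    by (intro add_mono ratio) auto
  finally have "ennreal (\<gamma> * b' + 1 + b') \<le> ennreal (\<gamma>\<^sup>2 / 2 + 1 + a')"
    using a' b' \<gamma> by (simp add: ennreal_mult)
  then have "\<gamma> * b' + b' \<le> \<gamma>\<^sup>2 / 2 + a'"
    using a' by (subst (asm) ennreal_le_iff) auto
  with diff have "\<gamma> * b' \<le> \<gamma> * (3 / 2 * \<gamma>)"
    by (simp add: power2_eq_square)
  then have "b' \<le> 3 / 2 * \<gamma>"
    using \<gamma> by simp
  moreover have "\<gamma>\<^sup>2 \<le> \<gamma>"
    using \<gamma> by (simp add: power2_eq_square mult_left_le)
  ultimately have "a' \<le> 3 * \<gamma>"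
    using diff \<gamma> by simp
  then show ?thesis
    using a' by (simp add: a_def P_def ennreal_leI)
qed

section \<open>Posterior probabilities\<close>

locale bayes_model = iid_sample M X p0
  for M :: "'w measure" and X :: "nat \<Rightarrow> 'w \<Rightarrow> real" and p0 :: "real \<Rightarrow> real" +
  fixes F :: "(real \<Rightarrow> real) set" and Pr :: "nat \<Rightarrow> (real \<Rightarrow> real) measure"
  assumes model: "density_model F" and prior: "\<And>n. prior_on F (Pr n)"
begin

sublocale Pr: prob_space "Pr n" for n
  using prior by (simp add: prior_on_def)

section \<open>Measurability in the density variable\<close>

lemma sets_Pr [measurable_cong]: "sets (Pr n) = sets (weak_borel F)"
  using prior by (simp add: prior_on_def)

lemma space_Pr [simp]: "space (Pr n) = F"
  using sets_eq_imp_space_eq[OF sets_Pr] by (simp add: weak_borel_def space_measure_of_conv)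

lemma density_F: "q \<in> F \<Longrightarrow> prob_density q"
  using model by (simp add: density_model_def)

lemma measurable_eval:
  assumes [measurable]: "f \<in> N \<rightarrow>\<^sub>M Pr n" "g \<in> borel_measurable N"
  shows "(\<lambda>y. f y (g y)) \<in> borel_measurable N"
proof -
  have [measurable]: "(\<lambda>(q, x). q x) \<in> borel_measurable (Pr n \<Otimes>\<^sub>M borel)"
    using model unfolding density_model_def
    by (subst measurable_cong_sets[OF sets_pair_measure_cong[OF sets_Pr refl] refl]) simp
  have "(\<lambda>y. case (f y, g y) of (q, x) \<Rightarrow> q x) \<in> borel_measurable N"
    by measurable
  then show ?thesis
    by simp
qed

lemma measurable_likelihood_ratio:
  assumes [measurable]: "f \<in> N \<rightarrow>\<^sub>M M" "g \<in> N \<rightarrow>\<^sub>M Pr m"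
  shows "(\<lambda>y. ennreal (likelihood_ratio p0 n (\<lambda>i. X i (f y)) (g y))) \<in> borel_measurable N"
proof -
  have [measurable]: "(\<lambda>y. X i (f y)) \<in> borel_measurable N" if "i \<in> {1..n}" for i
    using measurable_X[of i] that by simp
  have [measurable]: "(\<lambda>y. g y (X i (f y))) \<in> borel_measurable N" if "i \<in> {1..n}" for i
    using that by (intro measurable_eval[where f = g and g = "\<lambda>y. X i (f y)"]) measurable
  show ?thesis
    unfolding likelihood_ratio_def by measurable
qed

text \<open>Unfolding the law gives a Lebesgue integral of \<open>q x * g x\<close>, for which joint
  measurability of evaluation suffices. Moments and cell masses of \<open>law q\<close> are both of
  this form.\<close>

lemma measurable_nn_integral_law:
  assumes [measurable]: "g \<in> borel_measurable borel"
  shows "(\<lambda>q. \<integral>\<^sup>+x. g x \<partial>law q) \<in> borel_measurable (Pr n)"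
proof -
  have [measurable]: "(\<lambda>y. fst y (snd y)) \<in> borel_measurable (Pr n \<Otimes>\<^sub>M lborel)"
    by (rule measurable_eval[where f = fst and g = snd]) measurable
  have "(\<lambda>q. \<integral>\<^sup>+x. ennreal (q x) * g x \<partial>lborel) \<in> borel_measurable (Pr n)"
    by (intro lborel.borel_measurable_nn_integral) (simp add: case_prod_beta')
  then show ?thesis
    by (subst measurable_cong[where g = "\<lambda>q. \<integral>\<^sup>+x. ennreal (q x) * g x \<partial>lborel"])
      (auto intro!: nn_integral_law density_F)
qed

lemma sets_abs_moment_le: "{q \<in> F. abs_moment r (law q) \<le> c} \<in> sets (Pr n)"
proof -
  have [measurable]: "(\<lambda>q. abs_moment r (law q)) \<in> borel_measurable (Pr n)"
    unfolding abs_moment_def by (intro measurable_nn_integral_law) measurable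
  have "{q \<in> space (Pr n). abs_moment r (law q) \<le> c} \<in> sets (Pr n)"
    by measurable
  then show ?thesis
    by simp
qed

lemma sets_emeasure_law_less:
  assumes "I \<in> sets borel"
  shows "{q \<in> F. emeasure (law q) I < c} \<in> sets (Pr n)"
proof -
  have "(\<lambda>q. \<integral>\<^sup>+x. indicator I x \<partial>law q) \<in> borel_measurable (Pr n)"
    using assms by (intro measurable_nn_integral_law) auto
  then have [measurable]: "(\<lambda>q. emeasure (law q) I) \<in> borel_measurable (Pr n)"
    using assms by simp
  have "{q \<in> space (Pr n). emeasure (law q) I < c} \<in> sets (Pr n)"
    by measurable
  then show ?thesis
    by simp
qed

abbreviation lik :: "nat \<Rightarrow> 'w \<Rightarrow> (real \<Rightarrow> real) \<Rightarrow> ennreal" where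
  "lik n \<omega> q \<equiv> ennreal (likelihood_ratio p0 n (\<lambda>i. X i \<omega>) q)"

abbreviation post :: "nat \<Rightarrow> 'w \<Rightarrow> (real \<Rightarrow> real) set \<Rightarrow> real" where
  "post n \<omega> A \<equiv> posterior (Pr n) p0 n (\<lambda>i. X i \<omega>) A"

lemma measurable_lik: "\<omega> \<in> space M \<Longrightarrow> lik n \<omega> \<in> borel_measurable (Pr m)"
  using measurable_likelihood_ratio[of "\<lambda>_. \<omega>" "Pr m" "\<lambda>q. q" m n] by simp

lemma pair_sigma_finite_Pr: "pair_sigma_finite M (Pr n)"
  by (intro pair_sigma_finite.intro) unfold_locales

section \<open>Lower bound for the denominator of the posterior\<close>

text \<open>By Fubini the integral \<open>G\<close> of \<open>L\<close> over \<open>V\<close> has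
  expectation at most \<open>3 * n * \<gamma> * v\<close>, where \<open>v\<close> is the prior mass
  of \<open>V\<close>. Markov's inequality over the data makes \<open>G\<close> at most
  \<open>n * b * v / 2\<close> off an event of probability \<open>6 * \<gamma> / b\<close>. Markov's
  inequality over the prior then leaves at least half of \<open>V\<close> with \<open>L\<close>
  below \<open>n * b\<close>.\<close>

lemma log_ratio_sum_bound:
  fixes b \<gamma> :: real and n :: nat
  assumes n: "0 < n" and b: "0 < b" and \<gamma>: "0 < \<gamma>" "\<gamma> \<le> 1"
  defines "V \<equiv> {q \<in> F. KL p0 q < ereal (\<gamma>\<^sup>2)}"
  defines "L \<equiv> \<lambda>\<omega> q. \<Sum>i\<in>{1..n}. e2ennreal (max 0 (log_ratio p0 q (X i \<omega>)))"
  assumes V: "V \<in> sets (Pr n)" and pos: "0 < measure (Pr n) V"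
  shows "\<exists>B\<in>sets M. emeasure M B \<le> ennreal (6 * \<gamma> / b) \<and> (\<forall>\<omega>\<in>space M - B.
    {q \<in> V. L \<omega> q < ennreal (real n * b)} \<in> sets (Pr n) \<and>
    measure (Pr n) V / 2 \<le> measure (Pr n) {q \<in> V. L \<omega> q < ennreal (real n * b)})"
proof -
  interpret pair: pair_sigma_finite M "Pr n"
    by (rule pair_sigma_finite_Pr)
  note V [measurable]
  define v where "v = measure (Pr n) V"
  have v: "emeasure (Pr n) V = ennreal v" "0 < v"
    using pos by (simp_all add: v_def Pr.emeasure_eq_measure)
  define G where "G \<omega> = (\<integral>\<^sup>+q. L \<omega> q * indicator V q \<partial>Pr n)" for \<omega>
  have L_meas: "(\<lambda>y. L (f y) (g y)) \<in> borel_measurable N"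
    if [measurable]: "f \<in> N \<rightarrow>\<^sub>M M" "g \<in> N \<rightarrow>\<^sub>M Pr n" for N :: "'z measure" and f g
  proof -
    have [measurable]: "(\<lambda>y. X i (f y)) \<in> borel_measurable N" if "i \<in> {1..n}" for i
      using measurable_X[of i] that by simp
    have [measurable]: "(\<lambda>y. log_ratio p0 (g y) (X i (f y))) \<in> borel_measurable N" if "i \<in> {1..n}" for i
      using that by (intro measurable_log_ratio measurable_eval[where f = g and g = "\<lambda>y. X i (f y)"]) measurable
    show ?thesis
      unfolding L_def by measurable
  qed
  have [measurable]: "(\<lambda>y. L (fst y) (snd y)) \<in> borel_measurable (M \<Otimes>\<^sub>M Pr n)"
    by (intro L_meas) auto
  have G_meas [measurable]: "G \<in> borel_measurable M"
    unfolding G_def by (intro Pr.borel_measurable_nn_integral) (simp add: case_prod_beta')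
  have inner: "(\<integral>\<^sup>+\<omega>. L \<omega> q \<partial>M) \<le> ennreal (real n * (3 * \<gamma>))" if "q \<in> V" for q
  proof -
    have q: "prob_density q" "KL p0 q < ereal (\<gamma>\<^sup>2)"
      using that by (auto simp: V_def density_F)
    have [measurable]: "q \<in> borel_measurable borel"
      using q by (intro prob_density_measurable)
    have [measurable]: "(\<lambda>x. log_ratio p0 q x) \<in> borel_measurable borel"
      by (intro measurable_log_ratio) auto
    have [measurable]: "X i \<in> borel_measurable M" if "i \<in> {1..n}" for i
      using measurable_X[of i] that by simp
    have "(\<integral>\<^sup>+\<omega>. L \<omega> q \<partial>M) = (\<Sum>i\<in>{1..n}. \<integral>\<^sup>+\<omega>. e2ennreal (max 0 (log_ratio p0 q (X i \<omega>))) \<partial>M)"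
      unfolding L_def by (intro nn_integral_sum) measurable
    also have "\<dots> = (\<Sum>i\<in>{1..n}. \<integral>\<^sup>+x. e2ennreal (max 0 (log_ratio p0 q x)) \<partial>law p0)"
      by (intro sum.cong refl nn_integral_X) auto
    also have "\<dots> \<le> (\<Sum>i\<in>{1..n}. ennreal (3 * \<gamma>))"
      by (intro sum_mono nn_integral_log_ratio_le q \<gamma>)
    also have "\<dots> = ennreal (real n * (3 * \<gamma>))"
      using \<gamma> by (simp add: ennreal_of_nat_eq_real_of_nat ennreal_mult)
    finally show ?thesis .
  qed
  have "(\<integral>\<^sup>+\<omega>. G \<omega> \<partial>M) = (\<integral>\<^sup>+q. \<integral>\<^sup>+\<omega>. L \<omega> q * indicator V q \<partial>M \<partial>Pr n)"
    unfolding G_def by (intro pair.Fubini'[symmetric]) (simp add: case_prod_beta')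
  also have "\<dots> \<le> (\<integral>\<^sup>+q. ennreal (real n * (3 * \<gamma>)) * indicator V q \<partial>Pr n)"
    using inner by (intro nn_integral_mono) (auto split: split_indicator)
  also have "\<dots> = ennreal (real n * (3 * \<gamma>)) * ennreal v"
    using v by (simp add: nn_integral_cmult_indicator)
  finally have G_int: "(\<integral>\<^sup>+\<omega>. G \<omega> \<partial>M) \<le> ennreal (real n * (3 * \<gamma>) * v)"
    using \<gamma> v by (simp add: ennreal_mult)
  \<comment> \<open>The level is chosen so that the second Markov bound, at level
    \<open>n * b\<close>, removes at most \<open>v / 2\<close> of the prior mass.\<close>
  define B where "B = {\<omega> \<in> space M. ennreal (real n * b * v / 2) \<le> G \<omega>}"
  have [measurable]: "B \<in> sets M"
    unfolding B_def by measurable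
  have "emeasure M B \<le> ennreal (1 / (real n * b * v / 2)) * (\<integral>\<^sup>+\<omega>. G \<omega> \<partial>M)"
    unfolding B_def using n b v by (intro nn_integral_Markov_real) auto
  also have "\<dots> \<le> ennreal (1 / (real n * b * v / 2)) * ennreal (real n * (3 * \<gamma>) * v)"
    by (intro mult_left_mono G_int) simp
  also have "\<dots> = ennreal (6 * \<gamma> / b)"
    using n b v \<gamma> by (subst ennreal_mult[symmetric]) (auto simp: field_simps)
  finally have "emeasure M B \<le> ennreal (6 * \<gamma> / b)" .
  moreover have "{q \<in> V. L \<omega> q < ennreal (real n * b)} \<in> sets (Pr n) \<and>
      v / 2 \<le> measure (Pr n) {q \<in> V. L \<omega> q < ennreal (real n * b)}" if "\<omega> \<in> space M - B" for \<omega>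
  proof
    let ?W = "{q \<in> V. L \<omega> q < ennreal (real n * b)}"
    let ?U = "{q \<in> space (Pr n). ennreal (real n * b) \<le> L \<omega> q * indicator V q}"
    have [measurable]: "L \<omega> \<in> borel_measurable (Pr n)"
      using that L_meas[of "\<lambda>_. \<omega>" "Pr n" "\<lambda>q. q"] by simp
    have "{q \<in> space (Pr n). q \<in> V \<and> L \<omega> q < ennreal (real n * b)} \<in> sets (Pr n)"
      by measurable
    also have "{q \<in> space (Pr n). q \<in> V \<and> L \<omega> q < ennreal (real n * b)} = ?W"
      by (auto simp: V_def)
    finally show W [measurable]: "?W \<in> sets (Pr n)" .
    have U [measurable]: "?U \<in> sets (Pr n)"
      by measurable
    have "G \<omega> \<le> ennreal (real n * b * v / 2)"
      using that by (auto simp: B_def)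
    have "emeasure (Pr n) ?U \<le> ennreal (1 / (real n * b)) * G \<omega>"
      unfolding G_def using n b by (intro nn_integral_Markov_real) auto
    also have "\<dots> \<le> ennreal (1 / (real n * b)) * ennreal (real n * b * v / 2)"
      by (intro mult_left_mono \<open>G \<omega> \<le> _\<close>) simp
    also have "\<dots> = ennreal (v / 2)"
      using n b v by (subst ennreal_mult[symmetric]) auto
    finally have "measure (Pr n) ?U \<le> v / 2"
      using v by (simp add: Pr.emeasure_eq_measure)
    moreover have "v \<le> measure (Pr n) (?W \<union> ?U)"
      unfolding v_def using sets.Un[OF W U]
      by (intro Pr.finite_measure_mono) (auto simp: V_def not_less)
    moreover have "measure (Pr n) (?W \<union> ?U) \<le> measure (Pr n) ?W + measure (Pr n) ?U"
      by (intro measure_Un_le W U)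
    ultimately show "v / 2 \<le> measure (Pr n) ?W"
      by linarith
  qed
  ultimately show ?thesis
    unfolding v_def[symmetric] using \<open>B \<in> sets M\<close> by blast
qed

text \<open>On the surviving half of the neighbourhood the likelihood ratio is at least
  \<open>exp (- n * b)\<close>, and that half has prior mass at least \<open>c / 2\<close>.\<close>

lemma evidence_lower_bound:
  fixes b c \<gamma> :: real
  assumes n: "0 < n" and b: "0 < b" and \<gamma>: "0 < \<gamma>" "\<gamma> \<le> 1" and c: "0 < c"
    and V: "ennreal c < emeasure (Pr n) {q \<in> F. KL p0 q < ereal (\<gamma>\<^sup>2)}"
  shows "\<exists>B\<in>sets M. emeasure M B \<le> ennreal (6 * \<gamma> / b) \<and> (\<forall>\<omega>\<in>space M - B.
    ennreal (c / 2 * exp (- (real n * b))) \<le> (\<integral>\<^sup>+q. lik n \<omega> q \<partial>Pr n))"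
proof -
  let ?V = "{q \<in> F. KL p0 q < ereal (\<gamma>\<^sup>2)}"
  let ?W = "\<lambda>\<omega>. {q \<in> ?V. (\<Sum>i\<in>{1..n}. e2ennreal (max 0 (log_ratio p0 q (X i \<omega>)))) < ennreal (real n * b)}"
  \<comment> \<open>A non-measurable set has \<open>emeasure\<close> 0, so the positive lower bound
    on the prior mass already makes the Kullback-Leibler neighbourhood measurable.\<close>
  have "?V \<in> sets (Pr n)"
    using V emeasure_notin_sets[of ?V "Pr n"] by (cases "?V \<in> sets (Pr n)") auto
  moreover have cV: "c < measure (Pr n) ?V"
    using V c by (simp add: Pr.emeasure_eq_measure ennreal_less_iff)
  ultimately obtain B where B: "B \<in> sets M" "emeasure M B \<le> ennreal (6 * \<gamma> / b)" and
    W: "\<And>\<omega>. \<omega> \<in> space M - B \<Longrightarrow> ?W \<omega> \<in> sets (Pr n) \<and> measure (Pr n) ?V / 2 \<le> measure (Pr n) (?W \<omega>)"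
    using log_ratio_sum_bound[OF n b \<gamma>] c by force
  \<comment> \<open>Samples that hit a zero of \<open>p0\<close> form a null event, which enlarges
    the exceptional event at no cost.\<close>
  obtain N where N: "N \<in> null_sets M" "{\<omega> \<in> space M. \<not> (\<forall>i\<in>{1..n}. 0 < p0 (X i \<omega>))} \<subseteq> N"
    using AE_X_pos[of n] unfolding eventually_ae_filter by blast
  have "ennreal (c / 2 * exp (- (real n * b))) \<le> (\<integral>\<^sup>+q. lik n \<omega> q \<partial>Pr n)"
    if "\<omega> \<in> space M - (B \<union> N)" for \<omega>
  proof -
    have p0_pos: "0 < p0 (X i \<omega>)" if "i \<in> {1..n}" for i
      using \<open>\<omega> \<in> _\<close> N(2) that by blast
    have W': "?W \<omega> \<in> sets (Pr n)" "c / 2 \<le> measure (Pr n) (?W \<omega>)"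
      using W[of \<omega>] that cV by force+
    have "ennreal (c / 2 * exp (- (real n * b))) \<le> ennreal (exp (- (real n * b)) * measure (Pr n) (?W \<omega>))"
      using W' by (intro ennreal_leI) (simp add: mult.commute)
    also have "\<dots> = (\<integral>\<^sup>+q. ennreal (exp (- (real n * b))) * indicator (?W \<omega>) q \<partial>Pr n)"
      using W'(1) by (simp add: nn_integral_cmult_indicator Pr.emeasure_eq_measure ennreal_mult)
    also have "\<dots> \<le> (\<integral>\<^sup>+q. lik n \<omega> q \<partial>Pr n)"
    proof (intro nn_integral_mono)
      fix q
      show "ennreal (exp (- (real n * b))) * indicator (?W \<omega>) q \<le> lik n \<omega> q"
      proof (cases "q \<in> ?W \<omega>")
        case True
        then have "exp (- (real n * b)) \<le> likelihood_ratio p0 n (\<lambda>i. X i \<omega>) q"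
          unfolding likelihood_ratio_def using p0_pos
          by (intro exp_le_prod_ratio) (auto intro: prob_density_nonneg density_F)
        then show ?thesis
          using True by (simp add: ennreal_leI)
      qed simp
    qed
    finally show ?thesis .
  qed
  moreover have "B \<union> N \<in> sets M" "emeasure M (B \<union> N) \<le> ennreal (6 * \<gamma> / b)"
    using B N(1) by (auto simp: emeasure_Un_null_set)
  ultimately show ?thesis
    by blast
qed

section \<open>Upper bound for the numerator of the posterior\<close>

lemma numerator_upper_bound:
  fixes \<eta> :: real
  assumes A: "A \<in> sets (Pr n)" and I [measurable]: "I \<in> sets borel" and \<eta>: "0 < \<eta>" "\<eta> \<le> 1"
    and le: "\<And>q. q \<in> A \<Longrightarrow> measure (law q) I \<le> measure (law p0) I - 2 * \<eta>"
  shows "\<exists>B\<in>sets M. emeasure M B \<le> ennreal (2 * exp (- (real n * (\<eta>\<^sup>2 / 8)))) \<and> (\<forall>\<omega>\<in>space M - B.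
    (\<integral>\<^sup>+q\<in>A. lik n \<omega> q \<partial>Pr n) \<le> ennreal (exp (- (real n * (\<eta>\<^sup>2 / 8)))))"
proof -
  interpret pair: pair_sigma_finite M "Pr n"
    by (rule pair_sigma_finite_Pr)
  note A [measurable]
  \<comment> \<open>The threshold lies midway in the gap: \<open>\<eta>\<close> below the mass of
    \<open>I\<close> under \<open>law p0\<close>, and at least \<open>\<eta>\<close> above its mass
    under any \<open>q\<close> in \<open>A\<close>.\<close>
  define c where "c = measure (law p0) I - \<eta>"
  \<comment> \<open>Half of the Chernoff rate \<open>\<eta>\<^sup>2 / 4\<close>. Markov's inequality
    at level \<open>exp (- n * \<beta>)\<close> spends one half and keeps the other as its
    probability bound.\<close>
  define \<beta> where "\<beta> = \<eta>\<^sup>2 / 8"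
  define g where "g x = ennreal (exp (\<eta> / 2 * (indicator I x - c)))" for x
  define S where "S \<omega> = (\<Sum>i\<in>{1..n}. indicator I (X i \<omega>) - c)" for \<omega>
  define W where "W \<omega> = (\<integral>\<^sup>+q. lik n \<omega> q * (\<Prod>i\<in>{1..n}. g (X i \<omega>)) * indicator A q \<partial>Pr n)" for \<omega>
  have AF: "A \<subseteq> F"
    using sets.sets_into_space[OF A] by simp
  have [measurable]: "g \<in> borel_measurable borel"
    unfolding g_def by measurable
  have [measurable]: "X i \<in> borel_measurable M" if "i \<in> {1..n}" for i
    using measurable_X[of i] that by simp
  have [measurable]: "(\<lambda>y. lik n (fst y) (snd y)) \<in> borel_measurable (M \<Otimes>\<^sub>M Pr n)"
    by (rule measurable_likelihood_ratio[where f = fst and g = snd]) measurable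
  have W_meas [measurable]: "W \<in> borel_measurable M"
    unfolding W_def by (intro Pr.borel_measurable_nn_integral) (simp add: case_prod_beta')
  have prod_g: "(\<Prod>i\<in>{1..n}. g (X i \<omega>)) = ennreal (exp (\<eta> / 2 * S \<omega>))" for \<omega>
    unfolding g_def S_def by (simp add: prod_ennreal sum_distrib_left exp_sum)
  have inner: "(\<integral>\<^sup>+\<omega>. lik n \<omega> q * (\<Prod>i\<in>{1..n}. g (X i \<omega>)) \<partial>M) \<le> ennreal (exp (- (real n * (2 * \<beta>))))"
    if "q \<in> A" for q
  proof -
    have q: "prob_density q"
      using that AF density_F by blast
    interpret Q: prob_space "law q"
      using q by (rule prob_density_prob_space)
    have [measurable]: "q \<in> borel_measurable borel"
      using q by (rule prob_density_measurable)
    have "lik n \<omega> q = (\<Prod>i\<in>{1..n}. ennreal (q (X i \<omega>) / p0 (X i \<omega>)))" for \<omega>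
      unfolding likelihood_ratio_def
      by (simp add: prod_ennreal prob_density_nonneg[OF q] prob_density_nonneg[OF density])
    then have "(\<integral>\<^sup>+\<omega>. lik n \<omega> q * (\<Prod>i\<in>{1..n}. g (X i \<omega>)) \<partial>M) =
        (\<integral>\<^sup>+\<omega>. (\<Prod>i\<in>{1..n}. ennreal (q (X i \<omega>) / p0 (X i \<omega>)) * g (X i \<omega>)) \<partial>M)"
      by (simp only: prod.distrib)
    also have "\<dots> = (\<integral>\<^sup>+x. ennreal (q x / p0 x) * g x \<partial>law p0) ^ n"
      by (intro nn_integral_prod_X[where g = "\<lambda>x. ennreal (q x / p0 x) * g x"]) measurable
    also have "\<dots> \<le> (\<integral>\<^sup>+x. g x \<partial>law q) ^ n"
      by (intro power_mono nn_integral_ratio_le q) auto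
    also have "\<dots> \<le> ennreal (exp (- (\<eta>\<^sup>2 / 4))) ^ n"
      unfolding g_def using le[OF that] \<eta>
      by (intro power_mono Q.nn_integral_exp_indicator_le) (auto simp: c_def)
    also have "\<dots> = ennreal (exp (- (real n * (2 * \<beta>))))"
      by (simp add: ennreal_power exp_of_nat_mult[symmetric] \<beta>_def)
    finally show ?thesis .
  qed
  have "(\<integral>\<^sup>+\<omega>. W \<omega> \<partial>M) =
      (\<integral>\<^sup>+q. \<integral>\<^sup>+\<omega>. lik n \<omega> q * (\<Prod>i\<in>{1..n}. g (X i \<omega>)) * indicator A q \<partial>M \<partial>Pr n)"
    unfolding W_def by (intro pair.Fubini'[symmetric]) (simp add: case_prod_beta')
  also have "\<dots> \<le> (\<integral>\<^sup>+q. ennreal (exp (- (real n * (2 * \<beta>)))) \<partial>Pr n)"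
    using inner by (intro nn_integral_mono) (auto split: split_indicator)
  also have "\<dots> = ennreal (exp (- (real n * (2 * \<beta>))))"
    using Pr.emeasure_space_1 by simp
  finally have W_int: "(\<integral>\<^sup>+\<omega>. W \<omega> \<partial>M) \<le> ennreal (exp (- (real n * (2 * \<beta>))))" .
  define B1 where "B1 = {\<omega> \<in> space M. ennreal (exp (- (real n * \<beta>))) \<le> W \<omega>}"
  define B2 where "B2 = {\<omega> \<in> space M. S \<omega> \<le> 0}"
  have B_meas [measurable]: "B1 \<in> sets M" "B2 \<in> sets M"
    unfolding B1_def B2_def S_def by measurable
  have "emeasure M B1 \<le> ennreal (1 / exp (- (real n * \<beta>))) * (\<integral>\<^sup>+\<omega>. W \<omega> \<partial>M)"
    unfolding B1_def by (intro nn_integral_Markov_real) auto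
  also have "\<dots> \<le> ennreal (1 / exp (- (real n * \<beta>))) * ennreal (exp (- (real n * (2 * \<beta>))))"
    by (intro mult_left_mono W_int) simp
  also have "\<dots> = ennreal (exp (- (real n * \<beta>)))"
    by (subst ennreal_mult[symmetric]) (auto simp: field_simps simp flip: exp_add)
  finally have B1: "emeasure M B1 \<le> ennreal (exp (- (real n * \<beta>)))" .
  have "emeasure M B2 \<le> ennreal (exp (- real n * \<eta>\<^sup>2 / 4))"
    unfolding B2_def S_def c_def by (intro emeasure_frequency_le I \<eta>)
  also have "\<dots> \<le> ennreal (exp (- (real n * \<beta>)))"
    unfolding \<beta>_def by (intro ennreal_leI) simp
  finally have B2: "emeasure M B2 \<le> ennreal (exp (- (real n * \<beta>)))" .
  have "emeasure M (B1 \<union> B2) \<le> emeasure M B1 + emeasure M B2"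
    by (intro emeasure_subadditive B_meas)
  also have "\<dots> \<le> ennreal (exp (- (real n * \<beta>))) + ennreal (exp (- (real n * \<beta>)))"
    by (intro add_mono B1 B2)
  also have "\<dots> = ennreal (2 * exp (- (real n * \<beta>)))"
    by (simp flip: ennreal_plus)
  finally have "emeasure M (B1 \<union> B2) \<le> ennreal (2 * exp (- (real n * \<beta>)))" .
  moreover have "(\<integral>\<^sup>+q\<in>A. lik n \<omega> q \<partial>Pr n) \<le> ennreal (exp (- (real n * \<beta>)))"
    if "\<omega> \<in> space M - (B1 \<union> B2)" for \<omega>
  proof -
    have "1 \<le> exp (\<eta> / 2 * S \<omega>)"
      using that \<eta> by (auto simp: B2_def)
    then have "1 \<le> (\<Prod>i\<in>{1..n}. g (X i \<omega>))"
      unfolding prod_g by simp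
    then have "lik n \<omega> q * 1 \<le> lik n \<omega> q * (\<Prod>i\<in>{1..n}. g (X i \<omega>))" for q
      by (intro mult_left_mono) auto
    then have "(\<integral>\<^sup>+q\<in>A. lik n \<omega> q \<partial>Pr n) \<le> W \<omega>"
      unfolding W_def by (intro nn_integral_mono mult_right_mono) auto
    also have "\<dots> \<le> ennreal (exp (- (real n * \<beta>)))"
      using that by (auto simp: B1_def)
    finally show ?thesis .
  qed
  ultimately show ?thesis
    unfolding \<beta>_def[symmetric] using B_meas by blast
qed

section \<open>Vanishing posterior mass of densities that underweight a set\<close>

text \<open>The numerator decays at rate \<open>\<beta>\<close> and the denominator at a rate of at
  most \<open>b = \<beta> / 2\<close>, so the quotient tends to 0. The order of choices matters:
  \<open>b\<close> comes from \<open>\<eta>\<close> alone, then \<open>\<gamma>\<close> makes the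
  failure probability of the denominator bound small, and only then is the prior mass bound
  \<open>c\<close> obtained for that \<open>\<gamma>\<close>.\<close>

lemma posterior_tendsto_zero:
  fixes \<eta> :: real
  assumes KL: "\<And>\<epsilon>::real. \<epsilon> > 0 \<Longrightarrow> liminf (\<lambda>n. emeasure (Pr n) {q \<in> F. KL p0 q < ereal \<epsilon>}) > 0"
    and A: "\<And>n. A \<in> sets (Pr n)" and I: "I \<in> sets borel" and \<eta>: "0 < \<eta>" "\<eta> \<le> 1"
    and le: "\<And>q. q \<in> A \<Longrightarrow> measure (law q) I \<le> measure (law p0) I - 2 * \<eta>"
  shows "tendsto_in_prob M (\<lambda>n \<omega>. post n \<omega> A) 0"
proof (rule tendsto_in_prob_zeroI)
  fix \<theta> \<tau> :: real assume \<theta>: "\<theta> > 0" and \<tau>: "\<tau> > 0"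
  define \<beta> where "\<beta> = \<eta>\<^sup>2 / 8"
  define b where "b = \<beta> / 2"
  have \<beta>: "0 < \<beta>" "0 < b"
    using \<eta> by (auto simp: \<beta>_def b_def)
  \<comment> \<open>This makes the failure probability \<open>6 * \<gamma> / b\<close> at most
    \<open>\<tau> / 2\<close>. The numerator bound gets the other half of
    \<open>\<tau>\<close>.\<close>
  define \<gamma> where "\<gamma> = min 1 (\<tau> * b / 12)"
  have \<gamma>: "0 < \<gamma>" "\<gamma> \<le> 1"
    using \<tau> \<beta> by (auto simp: \<gamma>_def)
  have "\<gamma> \<le> \<tau> * b / 12"
    by (simp add: \<gamma>_def)
  then have \<gamma>\<tau>: "6 * \<gamma> / b \<le> \<tau> / 2"
    using \<beta> by (simp add: field_simps)
  obtain c' where c': "0 < c'" "c' < liminf (\<lambda>n. emeasure (Pr n) {q \<in> F. KL p0 q < ereal (\<gamma>\<^sup>2)})"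
    using dense[OF KL[of "\<gamma>\<^sup>2"]] \<gamma> by auto
  then obtain c where c: "0 < c" "c' = ennreal c"
    by (cases c') auto
  have ev1: "eventually (\<lambda>n. ennreal c < emeasure (Pr n) {q \<in> F. KL p0 q < ereal (\<gamma>\<^sup>2)}) sequentially"
    using less_LiminfD[OF c'(2)] c by simp
  have lim: "(\<lambda>n. exp (- (real n * t))) \<longlonglongrightarrow> 0" if "0 < t" for t
    using LIMSEQ_realpow_zero[of "exp (- t)"] that by (simp add: exp_of_nat_mult[symmetric])
  have ev2: "eventually (\<lambda>n. exp (- (real n * \<beta>)) < \<tau> / 4) sequentially"
    using \<tau> by (intro order_tendstoD[OF lim[OF \<beta>(1)]]) simp
  have ev3: "eventually (\<lambda>n. exp (- (real n * b)) < \<theta> * c / 2) sequentially"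
    using \<theta> c by (intro order_tendstoD[OF lim[OF \<beta>(2)]]) simp
  show "eventually (\<lambda>n. \<exists>B\<in>sets M. {\<omega> \<in> space M. \<bar>post n \<omega> A\<bar> > \<theta>} \<subseteq> B \<and> emeasure M B \<le> ennreal \<tau>) sequentially"
    using ev1 ev2 ev3 eventually_gt_at_top[of 0]
  proof eventually_elim
    case (elim n)
    obtain B1 where B1: "B1 \<in> sets M" "emeasure M B1 \<le> ennreal (6 * \<gamma> / b)"
      "\<And>\<omega>. \<omega> \<in> space M - B1 \<Longrightarrow> ennreal (c / 2 * exp (- (real n * b))) \<le> (\<integral>\<^sup>+q. lik n \<omega> q \<partial>Pr n)"
      using evidence_lower_bound[OF elim(4) \<beta>(2) \<gamma> c(1) elim(1)] by blast
    obtain B2 where B2: "B2 \<in> sets M" "emeasure M B2 \<le> ennreal (2 * exp (- (real n * \<beta>)))"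
      "\<And>\<omega>. \<omega> \<in> space M - B2 \<Longrightarrow> (\<integral>\<^sup>+q\<in>A. lik n \<omega> q \<partial>Pr n) \<le> ennreal (exp (- (real n * \<beta>)))"
      using numerator_upper_bound[OF A I \<eta> le] unfolding \<beta>_def by blast
    have "emeasure M (B1 \<union> B2) \<le> emeasure M B1 + emeasure M B2"
      by (intro emeasure_subadditive B1 B2)
    also have "\<dots> \<le> ennreal (\<tau> / 2) + ennreal (\<tau> / 2)"
      using \<gamma>\<tau> elim(2) by (intro add_mono order.trans[OF B1(2)] order.trans[OF B2(2)] ennreal_leI) auto
    also have "\<dots> = ennreal \<tau>"
      using \<tau> by (simp flip: ennreal_plus)
    finally have "emeasure M (B1 \<union> B2) \<le> ennreal \<tau>" .
    moreover have "post n \<omega> A \<le> \<theta>" if "\<omega> \<in> space M - (B1 \<union> B2)" for \<omega>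
    proof -
      let ?D = "\<integral>\<^sup>+q. lik n \<omega> q \<partial>Pr n"
      have D: "ennreal (c / 2 * exp (- (real n * b))) \<le> ?D"
        using B1(3) that by blast
      \<comment> \<open>Since \<open>\<beta> = 2 * b\<close>, one factor matches the decay of the
        denominator, and the other lies below \<open>\<theta> * c / 2\<close> for large
        \<open>n\<close>.\<close>
      have "exp (- (real n * \<beta>)) = exp (- (real n * b)) * exp (- (real n * b))"
        by (simp add: b_def flip: exp_add)
      also have "\<dots> \<le> \<theta> * (c / 2 * exp (- (real n * b)))"
        using elim(3) by (simp add: mult_right_mono)
      finally have "(\<integral>\<^sup>+q\<in>A. lik n \<omega> q \<partial>Pr n) \<le> ennreal (\<theta> * (c / 2 * exp (- (real n * b))))"
        using that by (intro order.trans[OF B2(3)] ennreal_leI) auto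
      also have "\<dots> = ennreal \<theta> * ennreal (c / 2 * exp (- (real n * b)))"
        using \<theta> c by (intro ennreal_mult) auto
      also have "\<dots> \<le> ennreal \<theta> * ?D"
        by (intro mult_left_mono D) simp
      finally have "(\<integral>\<^sup>+q\<in>A. lik n \<omega> q \<partial>Pr n) \<le> ?D * ennreal \<theta>"
        by (simp add: mult.commute)
      moreover have "0 < ?D"
        using c by (intro less_le_trans[OF _ D]) simp
      ultimately have "(\<integral>\<^sup>+q\<in>A. lik n \<omega> q \<partial>Pr n) / ?D \<le> ennreal \<theta>"
        by (intro divide_le_posI_ennreal)
      then show ?thesis
        unfolding posterior_def using \<theta> by (intro enn2real_leI) auto
    qed
    then have "{\<omega> \<in> space M. \<bar>post n \<omega> A\<bar> > \<theta>} \<subseteq> B1 \<union> B2"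
      by (auto simp: not_less posterior_def abs_of_nonneg linorder_not_le[symmetric])
    ultimately show ?case
      using B1(1) B2(1) by blast
  qed
qed

section \<open>Subadditivity and complements for the posterior\<close>

text \<open>The degenerate cases obey the bound too: \<open>0 / 0\<close> and division by infinity
  both give 0. Hence the quotient is always finite, and \<open>enn2real\<close> in
  \<open>posterior\<close> loses nothing.\<close>

lemma set_nn_integral_lik_divide_le_1:
  "(\<integral>\<^sup>+q\<in>A. lik n \<omega> q \<partial>Pr n) / (\<integral>\<^sup>+q. lik n \<omega> q \<partial>Pr n) \<le> 1" (is "?N / ?D \<le> 1")
proof -
  have "?N \<le> ?D"
    by (intro nn_integral_mono) (auto split: split_indicator)
  then show ?thesis
    by (cases "?D = 0") (auto simp: zero_less_iff_neq_zero intro!: divide_le_posI_ennreal)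
qed

text \<open>No measurability of \<open>C\<close> is required, which matters for the set defined
  through \<open>wasserstein\<close>: monotonicity of the integral holds for arbitrary integrands,
  and additivity is used only for \<open>G\<close> and the \<open>A k\<close>.\<close>

lemma posterior_le_sum:
  assumes \<omega>: "\<omega> \<in> space M" and S: "finite S"
    and G: "G \<in> sets (Pr n)" and A: "\<And>k. k \<in> S \<Longrightarrow> A k \<in> sets (Pr n)"
    and sub: "C \<subseteq> G \<union> (\<Union>k\<in>S. A k)"
  shows "post n \<omega> C \<le> post n \<omega> G + (\<Sum>k\<in>S. post n \<omega> (A k))"
proof -
  note measurable_lik[OF \<omega>, measurable] G [measurable] A [measurable]
  let ?N = "\<lambda>A. \<integral>\<^sup>+q\<in>A. lik n \<omega> q \<partial>Pr n" and ?D = "\<integral>\<^sup>+q. lik n \<omega> q \<partial>Pr n"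
  have fin: "?N A / ?D < top" for A
    using set_nn_integral_lik_divide_le_1[of n \<omega> A] by (rule le_less_trans) simp
  have ind: "indicator C q \<le> indicator G q + (\<Sum>k\<in>S. indicator (A k) q :: ennreal)" for q
  proof (cases "q \<in> C \<and> q \<notin> G")
    case True
    then obtain k where "k \<in> S" "q \<in> A k"
      using sub by blast
    then have "1 \<le> (\<Sum>k\<in>S. indicator (A k) q :: ennreal)"
      using member_le_sum[of k S "\<lambda>k. indicator (A k) q :: ennreal"] S by simp
    then show ?thesis
      using True by simp
  qed (auto split: split_indicator)
  have "?N C \<le> (\<integral>\<^sup>+q. lik n \<omega> q * (indicator G q + (\<Sum>k\<in>S. indicator (A k) q)) \<partial>Pr n)"
    by (intro nn_integral_mono mult_left_mono ind) simp
  also have "\<dots> = ?N G + (\<Sum>k\<in>S. ?N (A k))"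
    using A by (simp add: distrib_left sum_distrib_left nn_integral_add nn_integral_sum)
  finally have "?N C / ?D \<le> ?N G / ?D + (\<Sum>k\<in>S. ?N (A k) / ?D)"
    unfolding divide_ennreal_def distrib_right[symmetric] sum_distrib_right[symmetric]
    by (rule mult_right_mono) simp
  moreover have fin_sum: "(\<Sum>k\<in>S. ?N (A k) / ?D) < top"
    using fin S by simp
  ultimately have "enn2real (?N C / ?D) \<le> enn2real (?N G / ?D + (\<Sum>k\<in>S. ?N (A k) / ?D))"
    using fin by (intro enn2real_mono) auto
  also have "\<dots> = enn2real (?N G / ?D) + (\<Sum>k\<in>S. enn2real (?N (A k) / ?D))"
    using fin fin_sum by (simp add: enn2real_plus enn2real_sum)
  finally show ?thesis
    by (simp add: posterior_def)
qed

text \<open>For a nondegenerate denominator the two posterior masses add up to 1 and equality holds.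
  If the denominator is 0 or infinite, both masses are 0, and only the inequality survives.\<close>

lemma posterior_Diff_le:
  assumes \<omega>: "\<omega> \<in> space M" and G: "G \<in> sets (Pr n)"
  shows "\<bar>post n \<omega> (F - G)\<bar> \<le> \<bar>post n \<omega> G - 1\<bar>"
proof -
  note measurable_lik[OF \<omega>, measurable] G [measurable]
  let ?N = "\<lambda>A. \<integral>\<^sup>+q\<in>A. lik n \<omega> q \<partial>Pr n" and ?D = "\<integral>\<^sup>+q. lik n \<omega> q \<partial>Pr n"
  have sum: "?N G + ?N (F - G) = ?D"
  proof -
    have [measurable]: "F - G \<in> sets (Pr n)"
      using sets.compl_sets[OF G] by simp
    have "?N G + ?N (F - G) = (\<integral>\<^sup>+q. lik n \<omega> q * indicator G q + lik n \<omega> q * indicator (F - G) q \<partial>Pr n)"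
      by (subst nn_integral_add) auto
    also have "\<dots> = ?D"
      by (intro nn_integral_cong) (auto split: split_indicator)
    finally show ?thesis .
  qed
  show ?thesis
  proof (cases "?D = 0 \<or> ?D = top")
    case True
    then have "post n \<omega> (F - G) = 0"
      using sum by (auto simp: posterior_def)
    then show ?thesis
      by simp
  next
    case False
    then have "?N G / ?D + ?N (F - G) / ?D = 1"
      unfolding add_divide_distrib_ennreal[symmetric] sum
      by (intro ennreal_divide_self) (auto simp: less_top)
    moreover have fin: "?N A / ?D < top" for A
      using set_nn_integral_lik_divide_le_1[of n \<omega> A] by (rule le_less_trans) simp
    ultimately have "post n \<omega> G + post n \<omega> (F - G) = 1"
      unfolding posterior_def enn2real_plus[OF fin fin, symmetric] by simp
    moreover have "0 \<le> post n \<omega> (F - G)"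
      by (simp add: posterior_def)
    ultimately show ?thesis
      by linarith
  qed
qed

end

section \<open>Couplings\<close>

text \<open>By Tonelli, integrating out one coordinate multiplies the measure of the other by a
  density that is constantly 1. Total mass 1 is then read off from a marginal.\<close>

lemma density_coupling:
  fixes P Q :: "real measure"
  assumes "prob_space P" "prob_space Q" and sets [measurable_cong]: "sets P = sets borel" "sets Q = sets borel"
    and [measurable]: "f \<in> borel_measurable (P \<Otimes>\<^sub>M Q)"
    and fst: "\<And>x. (\<integral>\<^sup>+y. f (x, y) \<partial>Q) = 1" and snd: "\<And>y. (\<integral>\<^sup>+x. f (x, y) \<partial>P) = 1"
  shows "density (P \<Otimes>\<^sub>M Q) f \<in> couplings P Q"
proof -
  interpret P: prob_space P by fact
  interpret Q: prob_space Q by fact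
  interpret PQ: pair_sigma_finite P Q ..
  let ?D = "density (P \<Otimes>\<^sub>M Q) f"
  have 1: "distr ?D borel fst = P"
  proof (rule measure_eqI)
    fix A assume "A \<in> sets (distr ?D borel fst)"
    then have A [measurable]: "A \<in> sets borel" by simp
    have "emeasure (distr ?D borel fst) A = (\<integral>\<^sup>+z. f z * indicator A (fst z) \<partial>(P \<Otimes>\<^sub>M Q))"
      by (subst emeasure_distr, measurable, subst emeasure_density, measurable)
        (auto intro!: nn_integral_cong split: split_indicator simp: space_pair_measure)
    also have "\<dots> = (\<integral>\<^sup>+x. \<integral>\<^sup>+y. f (x, y) * indicator A x \<partial>Q \<partial>P)"
      by (subst Q.nn_integral_fst[symmetric]) auto
    also have "\<dots> = (\<integral>\<^sup>+x. indicator A x \<partial>P)"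
      by (intro nn_integral_cong) (simp add: nn_integral_multc fst)
    finally show "emeasure (distr ?D borel fst) A = emeasure P A"
      by simp
  qed (simp add: sets)
  have 2: "distr ?D borel snd = Q"
  proof (rule measure_eqI)
    fix A assume "A \<in> sets (distr ?D borel snd)"
    then have A [measurable]: "A \<in> sets borel" by simp
    have "emeasure (distr ?D borel snd) A = (\<integral>\<^sup>+z. f z * indicator A (snd z) \<partial>(P \<Otimes>\<^sub>M Q))"
      by (subst emeasure_distr, measurable, subst emeasure_density, measurable)
        (auto intro!: nn_integral_cong split: split_indicator simp: space_pair_measure)
    also have "\<dots> = (\<integral>\<^sup>+y. \<integral>\<^sup>+x. f (x, y) * indicator A y \<partial>P \<partial>Q)"
      by (subst PQ.nn_integral_snd[symmetric]) auto
    also have "\<dots> = (\<integral>\<^sup>+y. indicator A y \<partial>Q)"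
      by (intro nn_integral_cong) (simp add: nn_integral_multc snd)
    finally show "emeasure (distr ?D borel snd) A = emeasure Q A"
      by simp
  qed (simp add: sets)
  have "sets (P \<Otimes>\<^sub>M Q) = sets borel"
    by (simp add: sets borel_prod[symmetric] cong: sets_pair_measure_cong)
  moreover have "prob_space ?D"
  proof -
    interpret D: prob_space "distr ?D borel fst"
      unfolding 1 by fact
    show ?thesis
      using D.emeasure_space_1 by (intro prob_spaceI) (simp add: emeasure_distr)
  qed
  ultimately show ?thesis
    using 1 2 by (simp add: couplings_def)
qed

lemma sum_indicator_disjoint_le_1:
  fixes t :: "'i \<Rightarrow> real"
  assumes "finite S" "disjoint_family_on I S" "\<And>k. k \<in> S \<Longrightarrow> t k \<le> 1"
  shows "(\<Sum>k\<in>S. t k * indicator (I k) x) \<le> 1"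
proof (cases "\<exists>k\<in>S. x \<in> I k")
  case True
  then obtain k where k: "k \<in> S" "x \<in> I k"
    by blast
  then have "(\<Sum>j\<in>S. t j * indicator (I j) x) = (\<Sum>j\<in>S. if j = k then t k else 0)"
    using assms(2) by (intro sum.cong refl) (auto simp: disjoint_family_on_def split: split_indicator)
  then show ?thesis
    using assms(1,3) k by simp
next
  case False
  then have "(\<Sum>k\<in>S. t k * indicator (I k) x) = 0"
    by (intro sum.neutral) auto
  then show ?thesis
    by simp
qed

text \<open>
  Mass \<open>w k * P (I k) * Q (I k)\<close> is moved inside the block \<open>I k\<close>; the remaining parts of \<open>P\<close> and
  \<open>Q\<close> are coupled independently.
\<close>
lemma block_coupling:
  fixes P Q :: "real measure" and w :: "'i \<Rightarrow> real"
  assumes P: "prob_space P" and Q: "prob_space Q"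
    and sets [measurable_cong]: "sets P = sets borel" "sets Q = sets borel"
    and S: "finite S" "disjoint_family_on I S" and I [measurable]: "\<And>k. k \<in> S \<Longrightarrow> I k \<in> sets borel"
    and w: "\<And>k. k \<in> S \<Longrightarrow> 0 \<le> w k"
    and wP: "\<And>k. k \<in> S \<Longrightarrow> w k * measure P (I k) \<le> 1"
    and wQ: "\<And>k. k \<in> S \<Longrightarrow> w k * measure Q (I k) \<le> 1"
    and c: "c = (\<Sum>k\<in>S. w k * measure P (I k) * measure Q (I k))" "c < 1"
    and [measurable]: "d \<in> borel_measurable (borel \<Otimes>\<^sub>M borel)"
      "\<phi> \<in> borel_measurable borel" "\<psi> \<in> borel_measurable borel"
    and d_block: "\<And>k x y. k \<in> S \<Longrightarrow> x \<in> I k \<Longrightarrow> y \<in> I k \<Longrightarrow> d (x, y) \<le> ennreal h"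
    and d_le: "\<And>x y. d (x, y) \<le> ennreal C + \<phi> x + \<psi> y" and "0 \<le> h" "0 \<le> C"
  shows "\<exists>\<pi>\<in>couplings P Q. (\<integral>\<^sup>+z. d z \<partial>\<pi>) \<le>
    ennreal h + ennreal (C * (1 - c)) + (\<integral>\<^sup>+x. \<phi> x \<partial>P) + (\<integral>\<^sup>+y. \<psi> y \<partial>Q)"
proof -
  interpret P: prob_space P by fact
  interpret Q: prob_space Q by fact
  interpret PQ: pair_sigma_finite P Q ..
  \<comment> \<open>\<open>a\<close> and \<open>b\<close> are the densities, with respect to
    \<open>P\<close> and \<open>Q\<close>, of the mass moved inside blocks. \<open>r\<close> and
    \<open>s\<close> are the densities of what remains, of total mass \<open>1 - c\<close> on either
    side. \<open>f1\<close> has marginal densities \<open>a\<close> and \<open>b\<close>. The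
    product \<open>f2\<close> has marginal densities \<open>r\<close> and \<open>s\<close> once it
    is divided by \<open>1 - c\<close>.\<close>
  define a where "a x = (\<Sum>k\<in>S. w k * measure Q (I k) * indicator (I k) x)" for x
  define b where "b y = (\<Sum>k\<in>S. w k * measure P (I k) * indicator (I k) y)" for y
  define r where "r x = ennreal (1 - a x)" for x
  define s where "s y = ennreal (1 - b y)" for y
  define f1 where "f1 z = (\<Sum>k\<in>S. ennreal (w k) * (indicator (I k) (fst z) * indicator (I k) (snd z)))"
    for z :: "real \<times> real"
  define f2 where "f2 z = ennreal (1 / (1 - c)) * (r (fst z) * s (snd z))" for z
  have [measurable]: "a \<in> borel_measurable borel" "b \<in> borel_measurable borel"
    unfolding a_def b_def by measurable
  have [measurable]: "r \<in> borel_measurable borel" "s \<in> borel_measurable borel"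
    unfolding r_def s_def by measurable
  have f_meas [measurable]: "f1 \<in> borel_measurable (borel \<Otimes>\<^sub>M borel)" "f2 \<in> borel_measurable (borel \<Otimes>\<^sub>M borel)"
    unfolding f1_def f2_def by measurable
  have a: "0 \<le> a x" "a x \<le> 1" and b: "0 \<le> b x" "b x \<le> 1" for x
  proof -
    show "0 \<le> a x" "0 \<le> b x"
      unfolding a_def b_def by (intro sum_nonneg mult_nonneg_nonneg w; simp)+
    show "a x \<le> 1" "b x \<le> 1"
      unfolding a_def b_def by (intro sum_indicator_disjoint_le_1 S wP wQ; assumption)+
  qed
  have c0: "0 \<le> c"
    unfolding c using w by (intro sum_nonneg) simp
  have r_add: "r x + ennreal (a x) = 1" and s_add: "s x + ennreal (b x) = 1" for x
    using a[of x] b[of x] by (simp_all add: r_def s_def flip: ennreal_plus)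
  have r_le: "r x \<le> 1" and s_le: "s x \<le> 1" for x
    using a[of x] b[of x] by (simp_all add: r_def s_def)
  have int_a: "(\<integral>\<^sup>+x. ennreal (a x) \<partial>P) = ennreal c"
  proof -
    have "(\<integral>\<^sup>+x. ennreal (a x) \<partial>P) =
        (\<integral>\<^sup>+x. (\<Sum>k\<in>S. ennreal (w k * measure Q (I k)) * indicator (I k) x) \<partial>P)"
      unfolding a_def using w
      by (intro nn_integral_cong) (simp add: sum_ennreal[symmetric] ennreal_mult ennreal_indicator)
    also have "\<dots> = (\<Sum>k\<in>S. ennreal (w k * measure Q (I k)) * ennreal (measure P (I k)))"
      by (simp add: nn_integral_sum nn_integral_cmult_indicator P.emeasure_eq_measure sets)
    also have "\<dots> = ennreal c"
      unfolding c using w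
      by (simp add: sum_ennreal[symmetric] ennreal_mult mult_ac)
    finally show ?thesis .
  qed
  have int_b: "(\<integral>\<^sup>+y. ennreal (b y) \<partial>Q) = ennreal c"
  proof -
    have "(\<integral>\<^sup>+x. ennreal (b x) \<partial>Q) =
        (\<integral>\<^sup>+x. (\<Sum>k\<in>S. ennreal (w k * measure P (I k)) * indicator (I k) x) \<partial>Q)"
      unfolding b_def using w
      by (intro nn_integral_cong) (simp add: sum_ennreal[symmetric] ennreal_mult ennreal_indicator)
    also have "\<dots> = (\<Sum>k\<in>S. ennreal (w k * measure P (I k)) * ennreal (measure Q (I k)))"
      by (simp add: nn_integral_sum nn_integral_cmult_indicator Q.emeasure_eq_measure sets)
    also have "\<dots> = ennreal c"
      unfolding c using w
      by (simp add: sum_ennreal[symmetric] ennreal_mult mult_ac)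
    finally show ?thesis .
  qed
  \<comment> \<open>Subtraction in \<open>ennreal\<close> is avoided by cancelling the finite
    summand \<open>c\<close>.\<close>
  have minus: "t = ennreal (1 - c)" if "t + ennreal c = 1" for t
  proof -
    have "ennreal (1 - c) + ennreal c = 1"
      using c0 c(2) by (simp flip: ennreal_plus)
    with that have "ennreal c + t = ennreal c + ennreal (1 - c)"
      by (simp add: add.commute)
    then show ?thesis
      unfolding ennreal_add_left_cancel by simp
  qed
  have int_r: "(\<integral>\<^sup>+x. r x \<partial>P) = ennreal (1 - c)"
  proof (rule minus)
    have "(\<integral>\<^sup>+x. r x \<partial>P) + ennreal c = (\<integral>\<^sup>+x. r x + ennreal (a x) \<partial>P)"
      unfolding int_a[symmetric] by (intro nn_integral_add[symmetric]) measurable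
    then show "(\<integral>\<^sup>+x. r x \<partial>P) + ennreal c = 1"
      using P.emeasure_space_1 by (simp add: r_add)
  qed
  have int_s: "(\<integral>\<^sup>+x. s x \<partial>Q) = ennreal (1 - c)"
  proof (rule minus)
    have "(\<integral>\<^sup>+x. s x \<partial>Q) + ennreal c = (\<integral>\<^sup>+x. s x + ennreal (b x) \<partial>Q)"
      unfolding int_b[symmetric] by (intro nn_integral_add[symmetric]) measurable
    then show "(\<integral>\<^sup>+x. s x \<partial>Q) + ennreal c = 1"
      using Q.emeasure_space_1 by (simp add: s_add)
  qed
  have cancel: "ennreal (1 / (1 - c)) * ennreal (1 - c) = 1"
    using c(2) by (subst ennreal_mult[symmetric]) auto
  have f1_fst: "(\<integral>\<^sup>+y. f1 (x, y) \<partial>Q) = ennreal (a x)" for x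
  proof -
    have "(\<integral>\<^sup>+y. f1 (x, y) \<partial>Q) = (\<Sum>k\<in>S. ennreal (w k) * (indicator (I k) x * ennreal (measure Q (I k))))"
      by (simp add: f1_def nn_integral_sum nn_integral_cmult Q.emeasure_eq_measure sets)
    also have "\<dots> = ennreal (a x)"
      unfolding a_def using w
      by (simp add: sum_ennreal[symmetric] ennreal_mult ennreal_indicator mult_ac)
    finally show ?thesis .
  qed
  have f1_snd: "(\<integral>\<^sup>+x. f1 (x, y) \<partial>P) = ennreal (b y)" for y
  proof -
    have "(\<integral>\<^sup>+x. f1 (x, y) \<partial>P) = (\<Sum>k\<in>S. ennreal (w k) * (ennreal (measure P (I k)) * indicator (I k) y))"
      by (simp add: f1_def nn_integral_sum nn_integral_cmult nn_integral_multc P.emeasure_eq_measure sets)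
    also have "\<dots> = ennreal (b y)"
      unfolding b_def using w
      by (simp add: sum_ennreal[symmetric] ennreal_mult ennreal_indicator mult_ac)
    finally show ?thesis .
  qed
  have f2_fst: "(\<integral>\<^sup>+y. f2 (x, y) \<partial>Q) = r x" for x
  proof -
    have "(\<integral>\<^sup>+y. f2 (x, y) \<partial>Q) = ennreal (1 / (1 - c)) * (r x * ennreal (1 - c))"
      unfolding f2_def by (simp add: nn_integral_cmult int_s)
    also have "\<dots> = r x * (ennreal (1 / (1 - c)) * ennreal (1 - c))"
      by (simp only: mult_ac)
    finally show ?thesis
      unfolding cancel by simp
  qed
  have f2_snd: "(\<integral>\<^sup>+x. f2 (x, y) \<partial>P) = s y" for y
  proof -
    have "(\<integral>\<^sup>+x. f2 (x, y) \<partial>P) = ennreal (1 / (1 - c)) * (ennreal (1 - c) * s y)"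
      unfolding f2_def by (simp add: nn_integral_cmult nn_integral_multc int_r)
    also have "\<dots> = s y * (ennreal (1 / (1 - c)) * ennreal (1 - c))"
      by (simp only: mult_ac)
    finally show ?thesis
      unfolding cancel by simp
  qed
  define \<pi> where "\<pi> = density (P \<Otimes>\<^sub>M Q) (\<lambda>z. f1 z + f2 z)"
  have "\<pi> \<in> couplings P Q"
    unfolding \<pi>_def
  proof (intro density_coupling P Q sets)
    show "(\<integral>\<^sup>+y. f1 (x, y) + f2 (x, y) \<partial>Q) = 1" for x
      using r_add[of x] by (subst nn_integral_add) (auto simp: f1_fst f2_fst add.commute)
    show "(\<integral>\<^sup>+x. f1 (x, y) + f2 (x, y) \<partial>P) = 1" for y
      using s_add[of y] by (subst nn_integral_add) (auto simp: f1_snd f2_snd add.commute)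
  qed measurable
  moreover have "(\<integral>\<^sup>+z. d z \<partial>\<pi>) \<le>
    ennreal h + ennreal (C * (1 - c)) + (\<integral>\<^sup>+x. \<phi> x \<partial>P) + (\<integral>\<^sup>+y. \<psi> y \<partial>Q)"
  proof -
    \<comment> \<open>\<open>f1\<close> vanishes unless both coordinates lie in a common block,
      where the cost is at most \<open>h\<close>.\<close>
    have f1d: "f1 z * d z \<le> ennreal h * f1 z" for z
    proof (cases "\<exists>k\<in>S. fst z \<in> I k \<and> snd z \<in> I k")
      case True
      then have "d z \<le> ennreal h"
        using d_block by (metis prod.collapse)
      then show ?thesis
        unfolding mult.commute[of "f1 z"] by (intro mult_right_mono) auto
    next
      case False
      then have "f1 z = 0"
        unfolding f1_def by (intro sum.neutral) (auto split: split_indicator)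
      then show ?thesis
        by simp
    qed
    have f2d: "f2 z * d z \<le> ennreal C * f2 z + f2 z * \<phi> (fst z) + f2 z * \<psi> (snd z)" for z
    proof -
      have "f2 z * d z \<le> f2 z * (ennreal C + \<phi> (fst z) + \<psi> (snd z))"
        using d_le[of "fst z" "snd z"] by (intro mult_left_mono) auto
      then show ?thesis
        by (simp add: distrib_left mult.commute)
    qed
    have "(\<integral>\<^sup>+z. d z \<partial>\<pi>) = (\<integral>\<^sup>+z. (f1 z + f2 z) * d z \<partial>(P \<Otimes>\<^sub>M Q))"
      unfolding \<pi>_def by (subst nn_integral_density) auto
    also have "\<dots> \<le> (\<integral>\<^sup>+z. ennreal h * f1 z +
        (ennreal C * f2 z + f2 z * \<phi> (fst z) + f2 z * \<psi> (snd z)) \<partial>(P \<Otimes>\<^sub>M Q))"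
      unfolding distrib_right by (intro nn_integral_mono add_mono f1d f2d)
    also have "\<dots> = ennreal h * (\<integral>\<^sup>+z. f1 z \<partial>(P \<Otimes>\<^sub>M Q)) + (ennreal C * (\<integral>\<^sup>+z. f2 z \<partial>(P \<Otimes>\<^sub>M Q)) +
        (\<integral>\<^sup>+z. f2 z * \<phi> (fst z) \<partial>(P \<Otimes>\<^sub>M Q)) + (\<integral>\<^sup>+z. f2 z * \<psi> (snd z) \<partial>(P \<Otimes>\<^sub>M Q)))"
      by (simp add: nn_integral_add nn_integral_cmult)
    also have "(\<integral>\<^sup>+z. f1 z \<partial>(P \<Otimes>\<^sub>M Q)) = ennreal c"
      by (subst Q.nn_integral_fst[symmetric]) (auto simp: f1_fst int_a)
    also have "(\<integral>\<^sup>+z. f2 z \<partial>(P \<Otimes>\<^sub>M Q)) = ennreal (1 - c)"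
      by (subst Q.nn_integral_fst[symmetric]) (auto simp: f2_fst int_r)
    also have "(\<integral>\<^sup>+z. f2 z * \<phi> (fst z) \<partial>(P \<Otimes>\<^sub>M Q)) = (\<integral>\<^sup>+x. r x * \<phi> x \<partial>P)"
      by (subst Q.nn_integral_fst[symmetric]) (auto simp: nn_integral_multc f2_fst)
    also have "(\<integral>\<^sup>+z. f2 z * \<psi> (snd z) \<partial>(P \<Otimes>\<^sub>M Q)) = (\<integral>\<^sup>+y. s y * \<psi> y \<partial>Q)"
      by (subst PQ.nn_integral_snd[symmetric]) (auto simp: nn_integral_multc f2_snd)
    \<comment> \<open>The residual densities \<open>r\<close> and \<open>s\<close> are at most 1, so
      the \<open>\<phi>\<close> and \<open>\<psi>\<close> terms are bounded by full integrals. The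
      constant \<open>C\<close> keeps its small factor \<open>1 - c\<close>.\<close>
    also have "ennreal h * ennreal c + (ennreal C * ennreal (1 - c) + (\<integral>\<^sup>+x. r x * \<phi> x \<partial>P) + (\<integral>\<^sup>+y. s y * \<psi> y \<partial>Q))
      \<le> ennreal h * 1 + (ennreal (C * (1 - c)) + (\<integral>\<^sup>+x. 1 * \<phi> x \<partial>P) + (\<integral>\<^sup>+y. 1 * \<psi> y \<partial>Q))"
      using c(2) \<open>0 \<le> C\<close>
      by (intro add_mono mult_left_mono nn_integral_mono mult_right_mono r_le s_le)
        (auto simp: ennreal_mult)
    finally show ?thesis
      by (simp add: add_ac)
  qed
  ultimately show ?thesis
    by blast
qed

section \<open>From cell masses to the Wasserstein distance\<close>

text \<open>Truncation at \<open>R\<close>: powers of values up to \<open>R\<close> are bounded by a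
  constant, while above \<open>R\<close> the excess exponent \<open>\<delta>\<close> yields the
  factor \<open>R powr (- \<delta>)\<close>. The moment terms thus become small for large
  \<open>R\<close>, at the price of a large constant.\<close>

lemma abs_diff_powr_le:
  fixes x y p \<delta> R :: real
  assumes "0 \<le> p" "0 \<le> \<delta>" "0 < R"
  shows "\<bar>x - y\<bar> powr p \<le> 2 powr p * (2 * R powr p) +
    2 powr p * R powr (- \<delta>) * \<bar>x\<bar> powr (p + \<delta>) + 2 powr p * R powr (- \<delta>) * \<bar>y\<bar> powr (p + \<delta>)"
proof -
  have tail: "t powr p \<le> R powr p + R powr (- \<delta>) * t powr (p + \<delta>)" if "0 \<le> t" for t
  proof (cases "t \<le> R")
    case True
    then have "t powr p \<le> R powr p"
      using that assms by (intro powr_mono2)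
    then show ?thesis
      by (simp add: add_increasing2)
  next
    case False
    then have "t powr p = t powr (- \<delta>) * t powr (p + \<delta>)"
      by (simp flip: powr_add)
    also have "\<dots> \<le> R powr (- \<delta>) * t powr (p + \<delta>)"
      using False assms by (intro mult_right_mono powr_mono2') auto
    finally show ?thesis
      by (simp add: add_increasing)
  qed
  have "\<bar>x - y\<bar> powr p \<le> (2 * max \<bar>x\<bar> \<bar>y\<bar>) powr p"
    using assms by (intro powr_mono2) auto
  also have "\<dots> = 2 powr p * max \<bar>x\<bar> \<bar>y\<bar> powr p"
    by (simp add: powr_mult)
  also have "max \<bar>x\<bar> \<bar>y\<bar> powr p \<le> \<bar>x\<bar> powr p + \<bar>y\<bar> powr p"
    by (simp add: max_def)
  also have "\<dots> \<le> (R powr p + R powr (- \<delta>) * \<bar>x\<bar> powr (p + \<delta>)) + (R powr p + R powr (- \<delta>) * \<bar>y\<bar> powr (p + \<delta>))"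
    by (intro add_mono tail) auto
  finally show ?thesis
    by (simp add: algebra_simps)
qed

lemma wasserstein_le_of_coupling:
  assumes "\<pi> \<in> couplings P Q" "(\<integral>\<^sup>+(x, y). ennreal (\<bar>x - y\<bar> powr p) \<partial>\<pi>) \<le> ennreal (\<epsilon> powr p)"
    and "0 < \<epsilon>" "0 < p"
  shows "wasserstein p P Q \<le> ennreal \<epsilon>"
proof -
  let ?J = "\<integral>\<^sup>+(x, y). ennreal (\<bar>x - y\<bar> powr p) \<partial>\<pi>"
  have "wasserstein p P Q \<le> ennreal_powr ?J (1 / p)"
    unfolding wasserstein_def using assms(1) by (intro INF_lower)
  also have "\<dots> = ennreal (enn2real ?J powr (1 / p))"
    using assms(2) by (auto simp: ennreal_powr_def top_unique)
  also have "\<dots> \<le> ennreal ((\<epsilon> powr p) powr (1 / p))"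
    using assms(2,4) by (intro ennreal_leI powr_mono2 enn2real_leI) auto
  also have "\<dots> = ennreal \<epsilon>"
    using assms(3,4) by (simp add: powr_powr)
  finally show ?thesis .
qed

text \<open>The transport cost splits into three parts of size at most
  \<open>e = \<epsilon> powr p / 3\<close>: movement within cells, the constant \<open>C\<close> on
  the remaining mass, and the moment tails. The cells and \<open>\<kappa>\<close> are fixed before
  \<open>Q\<close>, so a large distance, under the moment bound, forces one of finitely many events
  that do not depend on \<open>Q\<close>.\<close>

lemma wasserstein_le_of_cell_mass:
  fixes P0 :: "real measure"
  assumes P0: "prob_space P0" and sets_P0 [measurable_cong]: "sets P0 = sets borel"
    and p: "1 \<le> p" and \<delta>: "0 < \<delta>" and K: "0 < K" and \<epsilon>: "0 < \<epsilon>"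
    and mom: "abs_moment (p + \<delta>) P0 < \<infinity>"
  obtains S :: "int set" and J :: "int \<Rightarrow> real set" and \<kappa> :: real
  where "finite S" "\<And>k. J k \<in> sets borel" "0 < \<kappa>" "\<kappa> < 1"
    "\<And>k. k \<in> S \<Longrightarrow> 0 < measure P0 (J k)"
    "\<And>Q. prob_space Q \<Longrightarrow> sets Q = sets borel \<Longrightarrow> abs_moment (p + \<delta>) Q \<le> ennreal K \<Longrightarrow>
      (\<And>k. k \<in> S \<Longrightarrow> (1 - \<kappa>) * measure P0 (J k) \<le> measure Q (J k)) \<Longrightarrow>
      wasserstein p Q P0 \<le> ennreal \<epsilon>"
proof -
  interpret P0: prob_space P0 by fact
  obtain K0 where K0: "abs_moment (p + \<delta>) P0 = ennreal K0" "0 \<le> K0"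
    using mom by (cases "abs_moment (p + \<delta>) P0") auto
  define e where "e = \<epsilon> powr p / 3"
  have e: "0 < e"
    using \<epsilon> by (simp add: e_def)
  define D where "D = 2 powr p * (K + K0)"
  have D: "0 < D"
    using K K0 by (simp add: D_def)
  \<comment> \<open>\<open>R\<close> solves \<open>R powr (- \<delta>) * D = e\<close>, which gives
    the two moment terms a joint bound of \<open>e\<close>.\<close>
  define R where "R = (e / D) powr (- (1 / \<delta>))"
  have R: "0 < R" "R powr (- \<delta>) * D = e"
    using e D \<delta> by (simp_all add: R_def powr_powr)
  define C where "C = 2 powr p * (2 * R powr p)"
  have C: "0 < C"
    using R by (simp add: C_def)
  \<comment> \<open>Chosen after \<open>C\<close>: the uncoupled mass will be at most
    \<open>2 * \<kappa>\<close>, and \<open>C\<close> times that must not exceed \<open>e\<close>.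
    The bound \<open>1 / 2\<close> keeps \<open>\<kappa>\<close> below 1.\<close>
  define \<kappa> where "\<kappa> = min (1 / 2) (e / (2 * C))"
  have \<kappa>: "0 < \<kappa>" "\<kappa> < 1"
    using e C by (auto simp: \<kappa>_def)
  have "\<kappa> \<le> e / (2 * C)"
    by (simp add: \<kappa>_def)
  then have C\<kappa>: "C * (2 * \<kappa>) \<le> e"
    using C by (simp add: field_simps)
  define h where "h = e powr (1 / p)"
  have h: "0 < h" "h powr p = e"
    using e p by (simp_all add: h_def powr_powr)
  \<comment> \<open>Half-open cells of length \<open>h\<close> partition the line, and membership in
    a cell amounts to a value of \<open>floor\<close>.\<close>
  define J where "J k = {real_of_int k * h..<real_of_int (k + 1) * h}" for k :: int
  have J [measurable]: "J k \<in> sets borel" for k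
    by (simp add: J_def)
  have floor_J: "x \<in> J k \<longleftrightarrow> \<lfloor>x / h\<rfloor> = k" for x k
    using h by (auto simp: J_def floor_eq_iff field_simps)
  have disj: "disjoint_family_on J A" for A
    unfolding disjoint_family_on_def by (auto simp: floor_J)
  have diam: "\<bar>x - y\<bar> \<le> h" if "x \<in> J k" "y \<in> J k" for x y k
    using that by (auto simp: J_def algebra_simps)
  define A where "A N = {- (real N * h)..<real N * h}" for N
  have "(\<lambda>N. measure P0 (A N)) \<longlonglongrightarrow> measure P0 (\<Union>N. A N)"
  proof (rule P0.finite_Lim_measure_incseq)
    show "incseq A"
      unfolding A_def incseq_def using h by (auto intro!: order.trans[OF _ mult_right_mono] less_le_trans[OF _ mult_right_mono])
  qed (auto simp: A_def sets_P0)
  also have "(\<Union>N. A N) = space P0"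
  proof -
    have "x \<in> (\<Union>N. A N)" for x
    proof -
      obtain N :: nat where "\<bar>x\<bar> / h < real N"
        using reals_Archimedean2 by blast
      then have "\<bar>x\<bar> < real N * h"
        using h by (simp add: field_simps)
      then show ?thesis
        by (auto simp: A_def intro!: exI[of _ N])
    qed
    then show ?thesis
      using sets_eq_imp_space_eq[OF sets_P0] by auto
  qed
  finally have "(\<lambda>N. measure P0 (A N)) \<longlonglongrightarrow> 1"
    by (simp add: P0.prob_space)
  then have "eventually (\<lambda>N. 1 - \<kappa> < measure P0 (A N)) sequentially"
    using \<kappa> by (intro order_tendstoD) auto
  then obtain N where N: "1 - \<kappa> < measure P0 (A N)"
    by (auto simp: eventually_sequentially)
  \<comment> \<open>Cells of mass 0 are discarded without changing the sum. Positivity is needed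
    later, where the mass of a cell determines the gap in the test for that cell.\<close>
  define S where "S = {k \<in> {- int N..<int N}. 0 < measure P0 (J k)}"
  have S: "finite S" "\<And>k. k \<in> S \<Longrightarrow> 0 < measure P0 (J k)"
    unfolding S_def by (auto intro: finite_subset[of _ "{- int N..<int N}"])
  have "A N \<subseteq> (\<Union>k\<in>{- int N..<int N}. J k)"
  proof
    fix x assume "x \<in> A N"
    then have "- real N \<le> x / h" "x / h < real N"
      using h by (auto simp: A_def field_simps)
    then have "\<lfloor>x / h\<rfloor> \<in> {- int N..<int N}"
      by (simp add: le_floor_iff floor_less_iff)
    moreover have "x \<in> J \<lfloor>x / h\<rfloor>"
      by (simp add: floor_J)
    ultimately show "x \<in> (\<Union>k\<in>{- int N..<int N}. J k)"
      by blast
  qed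
  then have "measure P0 (A N) \<le> measure P0 (\<Union>k\<in>{- int N..<int N}. J k)"
    by (intro P0.finite_measure_mono) auto
  also have "\<dots> \<le> (\<Sum>k\<in>{- int N..<int N}. measure P0 (J k))"
    by (intro measure_UNION_le) (auto simp: sets_P0)
  also have "\<dots> = (\<Sum>k\<in>S. measure P0 (J k))"
    by (intro sum.mono_neutral_right) (auto simp: S_def zero_less_measure_iff)
  finally have sum_ge: "1 - \<kappa> \<le> (\<Sum>k\<in>S. measure P0 (J k))"
    using N by simp
  have "(\<Sum>k\<in>S. measure P0 (J k)) = measure P0 (\<Union>k\<in>S. J k)"
    using S disj by (intro P0.finite_measure_finite_Union[symmetric]) (auto simp: sets_P0)
  then have sum_le: "(\<Sum>k\<in>S. measure P0 (J k)) \<le> 1"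
    by simp
  show thesis
  proof (rule that[of S J \<kappa>])
    fix Q :: "real measure"
    assume Q: "prob_space Q" and sets_Q [measurable_cong]: "sets Q = sets borel"
      and momQ: "abs_moment (p + \<delta>) Q \<le> ennreal K"
      and le: "\<And>k. k \<in> S \<Longrightarrow> (1 - \<kappa>) * measure P0 (J k) \<le> measure Q (J k)"
    interpret Q: prob_space Q by fact
    \<comment> \<open>With this weight the mass coupled in cell \<open>k\<close> is
      \<open>(1 - \<kappa>)\<close> times its mass under \<open>P0\<close>. The requirement that it
      fit into \<open>Q\<close> is exactly the assumed lower bound on the cell mass.\<close>
    define w where "w k = (1 - \<kappa>) / measure Q (J k)" for k
    have Qpos: "0 < measure Q (J k)" if "k \<in> S" for k
      using le[OF that] S(2)[OF that] \<kappa> by (smt (verit) mult_pos_pos)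
    define c where "c = (\<Sum>k\<in>S. w k * measure Q (J k) * measure P0 (J k))"
    have c_eq: "c = (1 - \<kappa>) * (\<Sum>k\<in>S. measure P0 (J k))"
      unfolding c_def sum_distrib_left by (intro sum.cong refl) (use Qpos in \<open>force simp: w_def\<close>)
    have "c \<le> (1 - \<kappa>) * 1"
      unfolding c_eq using sum_le \<kappa> by (intro mult_left_mono) auto
    then have c1: "c < 1"
      using \<kappa> by simp
    \<comment> \<open>One factor is lost because the cells miss up to \<open>\<kappa>\<close> of the
      mass of \<open>P0\<close>, the other because only the fraction \<open>1 - \<kappa>\<close> is
      coupled in each cell.\<close>
    have "(1 - \<kappa>) * (1 - \<kappa>) \<le> c"
      unfolding c_eq using sum_ge \<kappa> by (intro mult_left_mono) auto
    moreover have "(1 - \<kappa>) * (1 - \<kappa>) = 1 - 2 * \<kappa> + \<kappa> * \<kappa>"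
      by (simp add: algebra_simps)
    ultimately have "1 - c \<le> 2 * \<kappa>"
      using zero_le_square[of \<kappa>] by linarith
    then have "C * (1 - c) \<le> C * (2 * \<kappa>)"
      using C by (intro mult_left_mono) auto
    with C\<kappa> have Cc: "C * (1 - c) \<le> e"
      by simp
    define B where "B = 2 powr p * R powr (- \<delta>)"
    have B: "0 \<le> B" "B * K + B * K0 = e"
      using R by (simp_all add: B_def D_def algebra_simps)
    define \<phi> where "\<phi> x = ennreal (B * \<bar>x\<bar> powr (p + \<delta>))" for x
    have \<phi>_int: "(\<integral>\<^sup>+x. \<phi> x \<partial>P) = ennreal B * abs_moment (p + \<delta>) P" if [measurable_cong]: "sets P = sets borel" for P
      unfolding \<phi>_def abs_moment_def using B by (simp add: ennreal_mult nn_integral_cmult)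
    obtain \<pi> where \<pi>: "\<pi> \<in> couplings Q P0" and cost: "(\<integral>\<^sup>+z. ennreal (\<bar>fst z - snd z\<bar> powr p) \<partial>\<pi>) \<le>
        ennreal e + ennreal (C * (1 - c)) + (\<integral>\<^sup>+x. \<phi> x \<partial>Q) + (\<integral>\<^sup>+y. \<phi> y \<partial>P0)"
    proof (rule bexE[OF block_coupling[OF Q P0 sets_Q sets_P0 S(1) disj J]])
      show "0 \<le> w k" for k
        using \<kappa> by (simp add: w_def)
      show "w k * measure Q (J k) \<le> 1" if "k \<in> S" for k
        using \<kappa> Qpos[OF that] by (simp add: w_def)
      show "w k * measure P0 (J k) \<le> 1" if "k \<in> S" for k
        using le[OF that] Qpos[OF that] by (simp add: w_def)
      show "c = (\<Sum>k\<in>S. w k * measure Q (J k) * measure P0 (J k))"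
        by (rule c_def)
      show "(\<lambda>z. ennreal (\<bar>fst z - snd z\<bar> powr p)) \<in> borel_measurable (borel \<Otimes>\<^sub>M borel)"
        by measurable
      show "\<phi> \<in> borel_measurable borel"
        unfolding \<phi>_def by measurable
      then show "\<phi> \<in> borel_measurable borel" .
      show "ennreal (\<bar>fst (x, y) - snd (x, y)\<bar> powr p) \<le> ennreal e" if "x \<in> J k" "y \<in> J k" for k x y
        unfolding h(2)[symmetric] using diam[OF that] p by (intro ennreal_leI powr_mono2) auto
      show "ennreal (\<bar>fst (x, y) - snd (x, y)\<bar> powr p) \<le> ennreal C + \<phi> x + \<phi> y" for x y
      proof -
        have "\<bar>x - y\<bar> powr p \<le> C + B * \<bar>x\<bar> powr (p + \<delta>) + B * \<bar>y\<bar> powr (p + \<delta>)"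
          unfolding C_def B_def using p \<delta> R by (intro abs_diff_powr_le) auto
        then have "ennreal (\<bar>x - y\<bar> powr p) \<le> ennreal (C + B * \<bar>x\<bar> powr (p + \<delta>) + B * \<bar>y\<bar> powr (p + \<delta>))"
          by (rule ennreal_leI)
        also have "\<dots> = ennreal C + \<phi> x + \<phi> y"
          unfolding \<phi>_def using B C by simp
        finally show ?thesis
          by simp
      qed
    qed (use c1 C e in auto)
    note cost
    also have "ennreal e + ennreal (C * (1 - c)) + (\<integral>\<^sup>+x. \<phi> x \<partial>Q) + (\<integral>\<^sup>+y. \<phi> y \<partial>P0) \<le>
        ennreal e + ennreal e + ennreal B * ennreal K + ennreal B * ennreal K0"
      unfolding \<phi>_int[OF sets_Q] \<phi>_int[OF sets_P0] K0(1)
      by (intro add_mono mult_left_mono momQ ennreal_leI Cc) auto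
    also have "\<dots> = ennreal (e + e + (B * K + B * K0))"
      using less_imp_le[OF e] B(1) less_imp_le[OF K] K0(2)
      by (simp only: ennreal_plus ennreal_mult add_nonneg_nonneg mult_nonneg_nonneg add.assoc)
    also have "\<dots> = ennreal (\<epsilon> powr p)"
      unfolding B(2) e_def by simp
    finally show "wasserstein p Q P0 \<le> ennreal \<epsilon>"
      using p \<epsilon> by (intro wasserstein_le_of_coupling[OF \<pi>]) (auto simp: case_prod_beta')
  qed (use S \<kappa> in auto)
qed

section \<open>Posterior consistency in the Wasserstein distance\<close>

theorem theorem2p2:
  fixes M :: "'w measure"
    and X :: "nat \<Rightarrow> 'w \<Rightarrow> real"
    and p0 :: "real \<Rightarrow> real"
    and F :: "(real \<Rightarrow> real) set"
    and Pr :: "nat \<Rightarrow> (real \<Rightarrow> real) measure"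
    and p K \<delta> :: real
  assumes "prob_space M"
    and "prob_density p0"
    and "prob_space.indep_vars M (\<lambda>_. borel) X {1..}"
    and "\<And>i. i \<ge> 1 \<Longrightarrow> distributed M lborel (X i) (\<lambda>x. ennreal (p0 x))"
    and "density_model F"
    and "\<And>n. prior_on F (Pr n)"
    and "p \<ge> 1"
    and "\<And>\<epsilon>::real. \<epsilon> > 0 \<Longrightarrow>
           liminf (\<lambda>n. emeasure (Pr n) {q \<in> F. KL p0 q < ereal \<epsilon>}) > 0"
    and "K > 0" and "\<delta> > 0"
    and "abs_moment (p + \<delta>) (law p0) < \<infinity>"
    and "tendsto_in_prob M
           (\<lambda>n \<omega>. posterior (Pr n) p0 n (\<lambda>i. X i \<omega>)
              {q \<in> F. abs_moment (p + \<delta>) (law q) \<le> ennreal K}) 1"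
  shows "\<forall>\<epsilon>>0. tendsto_in_prob M
           (\<lambda>n \<omega>. posterior (Pr n) p0 n (\<lambda>i. X i \<omega>)
              {q \<in> F. wasserstein p (law q) (law p0) > ennreal \<epsilon>}) 0"
proof (intro allI impI)
  fix \<epsilon> :: real assume "0 < \<epsilon>"
  interpret M: prob_space M by fact
  interpret bayes_model M X p0 F Pr
    using assms(2-6) by unfold_locales auto
  define G where "G = {q \<in> F. abs_moment (p + \<delta>) (law q) \<le> ennreal K}"
  have G: "G \<in> sets (Pr n)" "F - G \<in> sets (Pr n)" for n
    using sets_abs_moment_le[of "p + \<delta>" "ennreal K" n] sets.compl_sets[of G "Pr n"] by (auto simp: G_def)
  obtain S :: "int set" and J \<kappa> where S: "finite S" and J: "\<And>k. J k \<in> sets borel" and \<kappa>: "0 < \<kappa>" "\<kappa> < 1"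
    and pos: "\<And>k. k \<in> S \<Longrightarrow> 0 < measure (law p0) (J k)"
    and small: "\<And>Q. prob_space Q \<Longrightarrow> sets Q = sets borel \<Longrightarrow> abs_moment (p + \<delta>) Q \<le> ennreal K \<Longrightarrow>
      (\<And>k. k \<in> S \<Longrightarrow> (1 - \<kappa>) * measure (law p0) (J k) \<le> measure Q (J k)) \<Longrightarrow>
      wasserstein p Q (law p0) \<le> ennreal \<epsilon>"
    using wasserstein_le_of_cell_mass[OF P0.prob_space_axioms sets_law assms(7,10,9) \<open>0 < \<epsilon>\<close> assms(11)]
    by metis
  \<comment> \<open>\<open>emeasure\<close> is used here to match the available measurability lemma.
    \<open>A_iff\<close> translates to real-valued masses.\<close>
  define A where "A k = {q \<in> F. emeasure (law q) (J k) < ennreal ((1 - \<kappa>) * measure (law p0) (J k))}" for k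
  have A: "A k \<in> sets (Pr n)" for k n
    unfolding A_def by (intro sets_emeasure_law_less J)
  have A_iff: "q \<in> A k \<longleftrightarrow> measure (law q) (J k) < (1 - \<kappa>) * measure (law p0) (J k)" if "q \<in> F" for q k
  proof -
    interpret Q: prob_space "law q"
      using that by (intro prob_density_prob_space density_F)
    show ?thesis
      using that \<kappa> by (simp add: A_def Q.emeasure_eq_measure ennreal_less_iff)
  qed
  let ?C = "{q \<in> F. wasserstein p (law q) (law p0) > ennreal \<epsilon>}"
  \<comment> \<open>Contrapositive of \<open>small\<close>: a density far from \<open>p0\<close>
    violates the moment bound or underweights some cell.\<close>
  have sub: "?C \<subseteq> (F - G) \<union> (\<Union>k\<in>S. A k)"
  proof
    fix q assume q: "q \<in> ?C"
    show "q \<in> (F - G) \<union> (\<Union>k\<in>S. A k)"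
    proof (rule ccontr)
      assume "\<not> ?thesis"
      then have "wasserstein p (law q) (law p0) \<le> ennreal \<epsilon>"
        using q A_iff by (intro small) (auto simp: G_def not_less intro: prob_density_prob_space density_F)
      with q show False
        by (auto simp: not_le[symmetric])
    qed
  qed
  \<comment> \<open>With \<open>\<eta>\<close> equal to half of \<open>\<kappa>\<close> times the
    cell mass, the gap \<open>2 * \<eta>\<close> is precisely the deficit that defines
    \<open>A k\<close>. It is positive because cells in \<open>S\<close> have positive mass.\<close>
  have "tendsto_in_prob M (\<lambda>n \<omega>. post n \<omega> (A k)) 0" if k: "k \<in> S" for k
  proof (rule posterior_tendsto_zero[where I = "J k" and \<eta> = "\<kappa> * measure (law p0) (J k) / 2"])
    show "0 < \<kappa> * measure (law p0) (J k) / 2"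
      using \<kappa> pos[OF k] by simp
    have "\<kappa> * measure (law p0) (J k) \<le> 1 * 1"
      using \<kappa> by (intro mult_mono) auto
    then show "\<kappa> * measure (law p0) (J k) / 2 \<le> 1"
      by simp
    show "measure (law q) (J k) \<le> measure (law p0) (J k) - 2 * (\<kappa> * measure (law p0) (J k) / 2)"
      if "q \<in> A k" for q
    proof -
      have "q \<in> F"
        using that by (simp add: A_def)
      with that show ?thesis
        by (simp add: A_iff algebra_simps)
    qed
  qed (use assms(8) A J in auto)
  moreover have "tendsto_in_prob M (\<lambda>n \<omega>. post n \<omega> (F - G)) 0"
    using assms(12) unfolding G_def[symmetric]
    by (rule tendsto_in_prob_zero_mono) (intro posterior_Diff_le G)
  ultimately have "tendsto_in_prob M (\<lambda>n \<omega>. post n \<omega> (F - G) + (\<Sum>k\<in>S. post n \<omega> (A k))) 0"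
    by (intro tendsto_in_prob_zero_add tendsto_in_prob_zero_sum S)
  then show "tendsto_in_prob M (\<lambda>n \<omega>. post n \<omega> ?C) 0"
  proof (rule tendsto_in_prob_zero_mono)
    fix n \<omega> assume "\<omega> \<in> space M"
    then have "post n \<omega> ?C \<le> post n \<omega> (F - G) + (\<Sum>k\<in>S. post n \<omega> (A k))"
      by (intro posterior_le_sum S G A sub)
    then show "\<bar>post n \<omega> ?C\<bar> \<le> \<bar>post n \<omega> (F - G) + (\<Sum>k\<in>S. post n \<omega> (A k)) - 0\<bar>"
      by (simp add: posterior_def)
  qed
qed

end
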